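(* Let $\mathcal{M}$, $p$, $R$ be as in the context. There exists a constant $C>0$, independent of $t$, such that for any function $u\in L^2(\mathcal{M})$ with $\int_{\mathcal{M}}u(\mathbf{x})p(\mathbf{x})\,d\mu_{\mathbf{x}}=0$ and for any sufficiently small $t>0$, $$\frac{C_t}{t}\int_{\mathcal{M}}\int_{\mathcal{M}}R\left(\frac{|\mathbf{x}-\mathbf{y}|^2}{4t}\right)(u(\mathbf{x})-u(\mathbf{y}))^2p(\mathbf{x})p(\mathbf{y})\,d\mu_{\mathbf{x}}\,d\mu_{\mathbf{y}}\ \ge\ C\|u\|_{L^2(\mathcal{M})}^2.$$
   Context: $\mathcal{M}$ is a compact $C^\infty$ smooth $k$-dimensional submanifold isometrically embedded in $\mathbb{R}^d$ with the Euclidean metric; its boundary $\partial\mathcal{M}$ is also compact and $C^\infty$ smooth. $d\mu$ denotes the volume measure on $\mathcal{M}$. The coefficient $p\in C^1(\mathcal{M})$ satisfies $0<c_0\le p(\mathbf{x})\le c_1<\infty$ for constants $c_0,c_1$. The kernel $R:[0,\infty)\to\mathbb{R}$ is $C^2$, $R(r)\ge0$ for all $r\ge0$, $R(r)=0$ for $r>1$, and there is $\delta_0>0$ with $R(r)\ge\delta_0$ for $0\le r\le\frac12$. The normalizing factor is $C_t=(4\pi t)^{-k/2}$. "Sufficiently small $t$" means $t\le T_0$ for some $T_0>0$ independent of $u$.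
   Formalization: The manifold is additionally assumed connected (and of dimension k ≥ 1): on any disconnected M, a nonzero locally constant u with weighted mean zero makes the left side vanish for all small t, so the claim fails there. *)

theory Defs
  imports "HOL-Analysis.Analysis"
begin

text \<open>Functions of class \<open>C\<^sup>n\<close> on an \<^emph>\<open>open\<close> set \<open>S\<close>: the recursion goes through all
  directional derivatives. At \<open>n = 0\<close> only continuity is required, so \<open>C_on n\<close> makes all
  derivatives up to order \<open>n\<close> exist and be continuous.\<close>

primrec C_on :: "nat \<Rightarrow> ('a::euclidean_space \<Rightarrow> 'b::real_normed_vector) \<Rightarrow> 'a set \<Rightarrow> bool" where
  "C_on 0 f S \<longleftrightarrow> continuous_on S f"
| "C_on (Suc n) f S \<longleftrightarrow>
     (\<forall>x\<in>S. f differentiable (at x)) \<and>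
     (\<forall>v. C_on n (\<lambda>x. frechet_derivative f (at x) v) S)"

definition smooth_on :: "('a::euclidean_space \<Rightarrow> 'b::real_normed_vector) \<Rightarrow> 'a set \<Rightarrow> bool" where
  "smooth_on f S \<longleftrightarrow> (\<forall>n. C_on n f S)"

text \<open>Class \<open>C\<^sup>n\<close> on an arbitrary subset of Euclidean space (here: a submanifold): locally the
  restriction of a \<open>C\<^sup>n\<close> function on an open set of the ambient space.\<close>

definition C_on_subset ::
  "nat \<Rightarrow> ('a::euclidean_space \<Rightarrow> 'b::real_normed_vector) \<Rightarrow> 'a set \<Rightarrow> bool" where
  "C_on_subset n f M \<longleftrightarrow>
     (\<forall>x\<in>M. \<exists>W g. open W \<and> x \<in> W \<and> C_on n g W \<and> (\<forall>y \<in> W \<inter> M. g y = f y))"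

text \<open>Class \<open>C\<^sup>2\<close> on the half-line \<open>[0, \<infinity>)\<close>, with one-sided derivatives at \<open>0\<close>.\<close>

definition C2_halfline :: "(real \<Rightarrow> real) \<Rightarrow> bool" where
  "C2_halfline f \<longleftrightarrow>
     (\<exists>f' f''. (\<forall>r\<ge>0. (f has_real_derivative f' r) (at r within {0..})) \<and>
               (\<forall>r\<ge>0. (f' has_real_derivative f'' r) (at r within {0..})) \<and>
               continuous_on {0..} f'')"

definition half_space :: "'k::finite \<Rightarrow> (real^'k) set" where
  "half_space i = {x. 0 \<le> x $ i}"

text \<open>A local parametrization of \<open>M\<close>, possibly at the boundary, has as its domain the relatively
  open subset \<open>W \<inter> half_space i\<close> of a half-space. Smoothness up to the boundary is smoothness on
  the open set \<open>W\<close>; only the values on \<open>W \<inter> half_space i\<close> have to lie in \<open>M\<close>. Parametrizations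
  of the interior are those whose \<open>W\<close> lies in the open half-space.\<close>

definition local_parametrization ::
  "(real^'d) set \<Rightarrow> 'k::finite \<Rightarrow> (real^'k) set \<Rightarrow> (real^'k \<Rightarrow> real^'d) \<Rightarrow> bool" where
  "local_parametrization M i W \<phi> \<longleftrightarrow>
     open W \<and> smooth_on \<phi> W \<and>
     (\<forall>x \<in> W \<inter> half_space i. inj (frechet_derivative \<phi> (at x))) \<and>
     openin (top_of_set M) (\<phi> ` (W \<inter> half_space i)) \<and>
     (\<exists>\<psi>. homeomorphism (W \<inter> half_space i) (\<phi> ` (W \<inter> half_space i)) \<phi> \<psi>)"

text \<open>The dimension \<open>k\<close> is \<open>CARD('k)\<close>. The boundary, the set of all points \<open>\<phi> x\<close> with \<open>x $ i = 0\<close>,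
  may be empty; its smoothness is part of this notion of manifold with boundary, and it is
  closed in \<open>M\<close>, hence compact whenever \<open>M\<close> is. Every \<open>k \<ge> 1\<close> is the cardinality of a numeral type,
  which has class \<open>wellorder\<close>; so adding that class to \<open>'k\<close>, as the change of variables theorems
  of the library do, does not restrict the dimension.\<close>

definition smooth_submanifold :: "'k::finite itself \<Rightarrow> (real^'d) set \<Rightarrow> bool" where
  "smooth_submanifold _ M \<longleftrightarrow>
     (\<forall>y\<in>M. \<exists>(i::'k) W \<phi>. local_parametrization M i W \<phi> \<and> y \<in> \<phi> ` (W \<inter> half_space i))"

text \<open>The Riemannian volume density \<open>sqrt (det g)\<close>, where \<open>g = J\<^sup>T J\<close> is the metric induced from
  the ambient Euclidean space in the coordinates \<open>\<phi>\<close>.\<close>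

definition volume_density :: "(real^'k::finite \<Rightarrow> real^'d) \<Rightarrow> real^'k \<Rightarrow> real" where
  "volume_density \<phi> x =
     (let J = matrix (frechet_derivative \<phi> (at x)) in sqrt (det (transpose J ** J)))"

definition chart_volume ::
  "(real^'d) set \<Rightarrow> 'k::finite \<Rightarrow> (real^'k) set \<Rightarrow> (real^'k \<Rightarrow> real^'d) \<Rightarrow> (real^'d) measure" where
  "chart_volume M i W \<phi> =
     distr (density (restrict_space lborel (W \<inter> half_space i)) (\<lambda>x. ennreal (volume_density \<phi> x)))
           (restrict_space borel M) \<phi>"

text \<open>The Riemannian volume measure on the Borel sets of \<open>M\<close>. By the change of variables formula
  the chart volumes agree on the overlaps of chart images, so each of them is the restriction of
  one and the same measure to its chart image; that measure is their least upper bound in the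
  complete lattice of measures. The supremum is thus the unique measure giving \<open>\<phi> ` B\<close> the mass
  \<open>\<integral>\<^sub>B sqrt (det g)\<close> for every local parametrization.\<close>

definition volume_measure :: "'k::finite itself \<Rightarrow> (real^'d) set \<Rightarrow> (real^'d) measure" where
  "volume_measure _ M =
     Sup {chart_volume M i W \<phi> | (i::'k) W \<phi>. local_parametrization M i W \<phi>}"

definition L2_space :: "'a measure \<Rightarrow> ('a \<Rightarrow> real) set" where
  "L2_space \<mu> = {u \<in> borel_measurable \<mu>. integrable \<mu> (\<lambda>x. (u x)\<^sup>2)}"

definition L2_norm :: "'a measure \<Rightarrow> ('a \<Rightarrow> real) \<Rightarrow> real" where
  "L2_norm \<mu> u = sqrt (\<integral>x. (u x)\<^sup>2 \<partial>\<mu>)"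

end

theory Submission
  imports Defs
begin

text \<open>
  Since \<open>R \<ge> \<delta>0\<close> on \<open>[0, 1/2]\<close> and \<open>p \<ge> c0\<close>, the double integral is at least
  \<open>\<delta>0 c0\<^sup>2\<close> times the energy of \<open>u\<close> over the pairs of points at distance at most
  \<open>r = sqrt (2 t)\<close>, and \<open>C\<^sub>t / t\<close> is a constant multiple of \<open>r\<close> to the power \<open>- (k + 2)\<close>. The theorem
  is therefore a nonlocal Poincare inequality, to be proved for all \<open>r \<le> 1\<close> with one constant:
  the energy \<open>\<integral>\<integral> (u x - u y)\<^sup>2\<close> over \<^emph>\<open>all\<close> pairs is at most \<open>C / r ^ (k + 2)\<close> times the
  energy over the pairs at distance at most \<open>r\<close>. Functions of mean zero with respect to \<open>p \<mu>\<close> have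
  their \<open>L\<^sup>2\<close> norm controlled by the energy over all pairs
  (\<open>weighted_mean_zero_le_pair_energy\<close>).

  The Poincare inequality is first proved for a bounded convex set \<open>D\<close> in Euclidean space of
  dimension \<open>k\<close> (\<open>convex_nonlocal_poincare\<close>). Cut the segment from \<open>x\<close> to \<open>y\<close> into \<open>n\<close> equal pieces;
  by Cauchy--Schwarz \<open>(v x - v y)\<^sup>2\<close> is at most \<open>n\<close> times the sum of the \<open>n\<close> squared
  increments along the pieces. For each piece the linear map taking \<open>(x, y)\<close> to the end points of the
  piece has Jacobian \<open>1 / n ^ k\<close>, so integration bounds the full energy by
  \<open>n \<sqdot> n \<sqdot> n ^ k\<close> times the energy over the pairs at distance at most \<open>diam D / n\<close>. With \<open>n\<close> of
  the order of \<open>1 / r\<close> this is the right power of \<open>r\<close>, and no derivative of \<open>v\<close> occurs. Small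
  half-balls in charts are convex, their parametrizations are Lipschitz and their volume densities
  are bounded above and away from \<open>0\<close>, so the inequality is inherited by a neighbourhood of every
  point of \<open>M\<close> (\<open>locally_near_controlled\<close>).

  The passage to all of \<open>M\<close> uses that control of the energy over \<open>A \<times> B\<close> and over \<open>B \<times> C\<close> gives control
  over \<open>A \<times> C\<close> if \<open>B\<close> has positive measure: average
  \<open>(u x - u y)\<^sup>2 \<le> 2 (u x - u z)\<^sup>2 + 2 (u z - u y)\<^sup>2\<close> over \<open>z \<in> B\<close>. Hence having neighbourhoods \<open>A\<close>
  and \<open>B\<close> for which the energy over \<open>A \<times> B\<close> is controlled is an equivalence relation between points
  with open classes; on a connected \<open>M\<close> it holds for all pairs, and finitely many products
  \<open>A \<times> B\<close> cover the compact set \<open>M \<times> M\<close> (\<open>near_controlled_globalize\<close>).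

  What is needed of the volume measure is its value in one chart
  (\<open>nn_integral_volume_measure_chart\<close>). Being a supremum over all charts, it is bounded below by each
  chart volume trivially; that it is not larger on a chart image is the change of variables formula
  for transition maps, which only has to be applied at interior points because the boundary
  hyperplane of a half-space is a null set.
\<close>

section \<open>Chaining on convex sets\<close>

lemma nn_integral_lborel_shift:
  fixes f :: "'a::euclidean_space \<Rightarrow> ennreal"
  assumes [measurable]: "f \<in> borel_measurable borel"
  shows "(\<integral>\<^sup>+x. f (c + x) \<partial>lborel) = (\<integral>\<^sup>+x. f x \<partial>lborel)"
proof -
  have "(\<integral>\<^sup>+x. f x \<partial>lborel) = (\<integral>\<^sup>+x. f x \<partial>distr lborel borel ((+) c))"
    by (simp add: lborel_distr_plus)
  also have "\<dots> = (\<integral>\<^sup>+x. f (c + x) \<partial>lborel)"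
    by (simp add: nn_integral_distr)
  finally show ?thesis by simp
qed

lemma nn_integral_lborel_scale:
  fixes f :: "'a::euclidean_space \<Rightarrow> ennreal"
  assumes [measurable]: "f \<in> borel_measurable borel" and c: "c > 0"
  shows "ennreal (c ^ DIM('a)) * (\<integral>\<^sup>+x. f (c *\<^sub>R x) \<partial>lborel) = (\<integral>\<^sup>+x. f x \<partial>lborel)"
proof -
  have "(\<integral>\<^sup>+x. f x \<partial>lborel)
      = (\<integral>\<^sup>+x. f x \<partial>density (distr lborel borel (\<lambda>x. 0 + c *\<^sub>R x)) (\<lambda>_. \<bar>c\<bar> ^ DIM('a)))"
    using c by (subst lborel_affine[of c 0]) auto
  also have "\<dots> = ennreal (c ^ DIM('a)) * (\<integral>\<^sup>+x. f (c *\<^sub>R x) \<partial>lborel)"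
    using c by (simp add: nn_integral_density nn_integral_distr nn_integral_cmult)
  finally show ?thesis by simp
qed

lemma square_difference_telescope:
  fixes w :: "nat \<Rightarrow> real"
  shows "(w 0 - w n)\<^sup>2 \<le> real n * (\<Sum>j<n. (w j - w (Suc j))\<^sup>2)"
proof -
  have "w 0 - w n = (\<Sum>j<n. w j - w (Suc j))"
    by (induction n) auto
  then show ?thesis
    using sum_squared_le_sum_of_squares[of "\<lambda>j. w j - w (Suc j)" "{..<n}"]
    by (simp add: mult.commute)
qed

text \<open>The energy over all pairs is bounded by chaining along segments: replace \<open>y\<close> by \<open>x + h\<close> and walk from
  \<open>x\<close> to \<open>x + h\<close> in \<open>n\<close> steps of length \<open>norm h / n\<close>, which stay in \<open>D\<close> by convexity. In the exponent,
  \<open>DIM('a)\<close> comes from rescaling \<open>h\<close> to the length of one step, and \<open>2\<close> from Cauchy--Schwarz and the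
  number of steps.\<close>

lemma convex_nonlocal_poincare:
  fixes v :: "'a::euclidean_space \<Rightarrow> real"
  assumes v[measurable]: "v \<in> borel_measurable borel" and D[measurable]: "D \<in> sets borel"
    and D_conv: "convex D" and n: "n > 0"
    and diam: "\<And>x y. x \<in> D \<Longrightarrow> y \<in> D \<Longrightarrow> norm (x - y) \<le> d"
  shows "(\<integral>\<^sup>+x. \<integral>\<^sup>+y. ennreal ((v x - v y)\<^sup>2) * indicator D x * indicator D y \<partial>lborel \<partial>lborel)
    \<le> ennreal (real n ^ (DIM('a) + 2)) *
      (\<integral>\<^sup>+x. \<integral>\<^sup>+y. ennreal ((v x - v y)\<^sup>2) * indicator D x * indicator D y
          * indicator {..d / n} (norm (x - y)) \<partial>lborel \<partial>lborel)"
    (is "?L \<le> _ * ?R")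
proof -
  define F where "F x y = ennreal ((v x - v y)\<^sup>2) * indicator D x * indicator D y" for x y
  define G where "G x y = F x y * indicator {..d / n} (norm (x - y))" for x y
  have F_meas[measurable]: "case_prod F \<in> borel_measurable (borel \<Otimes>\<^sub>M borel)"
    unfolding F_def by measurable
  have G_meas[measurable]: "case_prod G \<in> borel_measurable (borel \<Otimes>\<^sub>M borel)"
    unfolding G_def by measurable
  \<comment> \<open>Pointwise chaining; the summands are admissible for \<open>G\<close> since every step has length at most \<open>d / n\<close>.\<close>
  have chain: "F x (x + h) \<le> (\<Sum>j<n. ennreal n * G (x + (j / n) *\<^sub>R h) (x + (j / n) *\<^sub>R h + (1 / n) *\<^sub>R h))" for x h
  proof (cases "x \<in> D \<and> x + h \<in> D")
    case True
    define z where "z j = x + (real j / real n) *\<^sub>R h" for j :: nat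
    have z_in: "z j \<in> D" if "j \<le> n" for j
    proof -
      have "z j = (1 - real j / n) *\<^sub>R x + (real j / n) *\<^sub>R (x + h)"
        by (simp add: z_def algebra_simps)
      then show ?thesis
        using convexD_alt[OF D_conv, of x "x + h" "real j / n"] True that n by (simp add: divide_simps)
    qed
    have z_Suc: "z j + (1 / n) *\<^sub>R h = z (Suc j)" for j
      by (simp add: z_def add_divide_distrib algebra_simps)
    have step: "norm (z j - z (Suc j)) \<le> d / n" for j
    proof -
      have "z j - z (Suc j) = - ((1 / n) *\<^sub>R h)" unfolding z_Suc[symmetric] by simp
      moreover have "norm h \<le> d" using diam[of x "x + h"] True by simp
      ultimately show ?thesis using n by (simp add: divide_right_mono)
    qed
    have "F x (x + h) = ennreal ((v (z 0) - v (z n))\<^sup>2)"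
      using True n by (simp add: F_def z_def)
    also have "\<dots> \<le> ennreal (real n * (\<Sum>j<n. (v (z j) - v (z (Suc j)))\<^sup>2))"
      by (intro ennreal_leI square_difference_telescope)
    also have "\<dots> = (\<Sum>j<n. ennreal n * ennreal ((v (z j) - v (z (Suc j)))\<^sup>2))"
      by (simp add: sum_distrib_left ennreal_mult[symmetric])
    also have "\<dots> = (\<Sum>j<n. ennreal n * G (z j) (z (Suc j)))"
      using z_in step by (intro sum.cong refl) (simp add: G_def F_def)
    finally show ?thesis by (simp add: z_Suc[symmetric]) (simp add: z_def)
  qed (auto simp: F_def)
  \<comment> \<open>Translating \<open>x\<close> makes the contribution of a step independent of its position \<open>a\<close> on the segment.\<close>
  have piece: "(\<integral>\<^sup>+x. \<integral>\<^sup>+h. G (x + a *\<^sub>R h) (x + a *\<^sub>R h + (1 / n) *\<^sub>R h) \<partial>lborel \<partial>lborel)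
      = ennreal (real n ^ DIM('a)) * (\<integral>\<^sup>+x. \<integral>\<^sup>+y. G x y \<partial>lborel \<partial>lborel)" for a :: real
  proof -
    have "(\<integral>\<^sup>+x. \<integral>\<^sup>+h. G (x + a *\<^sub>R h) (x + a *\<^sub>R h + (1 / n) *\<^sub>R h) \<partial>lborel \<partial>lborel)
        = (\<integral>\<^sup>+h. \<integral>\<^sup>+x. G (x + a *\<^sub>R h) (x + a *\<^sub>R h + (1 / n) *\<^sub>R h) \<partial>lborel \<partial>lborel)"
      by (intro lborel_pair.Fubini') measurable
    also have "\<dots> = (\<integral>\<^sup>+h. \<integral>\<^sup>+x. G x (x + (1 / n) *\<^sub>R h) \<partial>lborel \<partial>lborel)"
    proof (rule nn_integral_cong)
      fix h :: 'a
      show "(\<integral>\<^sup>+x. G (x + a *\<^sub>R h) (x + a *\<^sub>R h + (1 / n) *\<^sub>R h) \<partial>lborel)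
          = (\<integral>\<^sup>+x. G x (x + (1 / n) *\<^sub>R h) \<partial>lborel)"
        using nn_integral_lborel_shift[of "\<lambda>x. G x (x + (1 / n) *\<^sub>R h)" "a *\<^sub>R h"]
        by (simp add: add.commute add.left_commute)
    qed
    also have "\<dots> = (\<integral>\<^sup>+x. \<integral>\<^sup>+h. G x (x + (1 / n) *\<^sub>R h) \<partial>lborel \<partial>lborel)"
      by (intro lborel_pair.Fubini') measurable
    also have "\<dots> = (\<integral>\<^sup>+x. ennreal (real n ^ DIM('a)) * (\<integral>\<^sup>+h. G x (x + h) \<partial>lborel) \<partial>lborel)"
    proof (intro nn_integral_cong)
      fix x
      have "(\<integral>\<^sup>+h. G x (x + (1 / n) *\<^sub>R h) \<partial>lborel)
          = ennreal (real n ^ DIM('a)) * (\<integral>\<^sup>+h. G x (x + (1 / n) *\<^sub>R (real n *\<^sub>R h)) \<partial>lborel)"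
        using n by (subst nn_integral_lborel_scale) auto
      then show "(\<integral>\<^sup>+h. G x (x + (1 / n) *\<^sub>R h) \<partial>lborel)
          = ennreal (real n ^ DIM('a)) * (\<integral>\<^sup>+h. G x (x + h) \<partial>lborel)"
        using n by simp
    qed
    also have "\<dots> = (\<integral>\<^sup>+x. ennreal (real n ^ DIM('a)) * (\<integral>\<^sup>+y. G x y \<partial>lborel) \<partial>lborel)"
      by (intro nn_integral_cong arg_cong2[where f="(*)"] refl nn_integral_lborel_shift) measurable
    also have "\<dots> = ennreal (real n ^ DIM('a)) * (\<integral>\<^sup>+x. \<integral>\<^sup>+y. G x y \<partial>lborel \<partial>lborel)"
      by (intro nn_integral_cmult) measurable
    finally show ?thesis .
  qed
  have "?L = (\<integral>\<^sup>+x. \<integral>\<^sup>+h. F x (x + h) \<partial>lborel \<partial>lborel)"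
    unfolding F_def[symmetric] by (intro nn_integral_cong nn_integral_lborel_shift[symmetric]) measurable
  also have "\<dots> \<le> (\<integral>\<^sup>+x. \<integral>\<^sup>+h. (\<Sum>j<n. ennreal n * G (x + (j / n) *\<^sub>R h) (x + (j / n) *\<^sub>R h + (1 / n) *\<^sub>R h))
      \<partial>lborel \<partial>lborel)"
    by (intro nn_integral_mono chain)
  also have "\<dots> = (\<Sum>j<n. ennreal n * (\<integral>\<^sup>+x. \<integral>\<^sup>+h. G (x + (j / n) *\<^sub>R h) (x + (j / n) *\<^sub>R h + (1 / n) *\<^sub>R h)
      \<partial>lborel \<partial>lborel))"
    by (simp add: nn_integral_sum nn_integral_cmult)
  also have "\<dots> = (\<Sum>j<n. ennreal n * (ennreal (real n ^ DIM('a)) * ?R))"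
    by (simp only: piece) (simp add: G_def F_def)
  also have "\<dots> = ennreal (real n ^ (DIM('a) + 2)) * ?R"
  proof -
    have "ennreal (real n ^ (DIM('a) + 2)) = ennreal n * (ennreal n * ennreal (real n ^ DIM('a)))"
      by (simp add: ennreal_mult[symmetric] power2_eq_square power_add algebra_simps)
    then show ?thesis
      by (simp add: ennreal_of_nat_eq_real_of_nat mult.assoc)
  qed
  finally show ?thesis .
qed

section \<open>Energies of pairs and their propagation\<close>

definition pair_energy :: "'a measure \<Rightarrow> ('a \<Rightarrow> real) \<Rightarrow> 'a set \<Rightarrow> 'a set \<Rightarrow> ennreal" where
  "pair_energy \<mu> u A B =
     (\<integral>\<^sup>+x. \<integral>\<^sup>+y. ennreal ((u x - u y)\<^sup>2) * indicator A x * indicator B y \<partial>\<mu> \<partial>\<mu>)"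

definition near_energy :: "'a::metric_space measure \<Rightarrow> ('a \<Rightarrow> real) \<Rightarrow> real \<Rightarrow> ennreal" where
  "near_energy \<mu> u r =
     (\<integral>\<^sup>+x. \<integral>\<^sup>+y. ennreal ((u x - u y)\<^sup>2) * indicator {..r} (dist x y) \<partial>\<mu> \<partial>\<mu>)"

text \<open>The constant must not depend on the scale \<open>r\<close> nor on \<open>u\<close>. In the application \<open>m\<close> is the dimension
  plus \<open>2\<close>, the power of \<open>r\<close> that chaining along segments costs. The function \<open>u\<close>
  ranges over all measurable functions, the energies being allowed to be infinite.\<close>

definition near_controlled :: "'a::metric_space measure \<Rightarrow> nat \<Rightarrow> 'a set \<Rightarrow> 'a set \<Rightarrow> bool" where
  "near_controlled \<mu> m A B \<longleftrightarrow>
     (\<exists>C\<ge>0. \<forall>u \<in> borel_measurable \<mu>. \<forall>r. 0 < r \<and> r \<le> 1 \<longrightarrow>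
        pair_energy \<mu> u A B \<le> ennreal (C / r ^ m) * near_energy \<mu> u r)"

lemma pair_energy_mono:
  assumes "A \<subseteq> A'" "B \<subseteq> B'"
  shows "pair_energy \<mu> u A B \<le> pair_energy \<mu> u A' B'"
  unfolding pair_energy_def using assms
  by (intro nn_integral_mono) (auto split: split_indicator)

lemma near_controlled_mono:
  assumes "near_controlled \<mu> m A' B'" "A \<subseteq> A'" "B \<subseteq> B'"
  shows "near_controlled \<mu> m A B"
  using assms(1) pair_energy_mono[OF assms(2,3)] unfolding near_controlled_def
  by (meson order_trans)

context finite_measure
begin

lemma pair_energy_commute:
  assumes [measurable]: "u \<in> borel_measurable M" "A \<in> sets M" "B \<in> sets M"
  shows "pair_energy M u A B = pair_energy M u B A"
proof -
  interpret pair_sigma_finite M M by standard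
  have "pair_energy M u A B
      = (\<integral>\<^sup>+y. \<integral>\<^sup>+x. ennreal ((u x - u y)\<^sup>2) * indicator A x * indicator B y \<partial>M \<partial>M)"
    unfolding pair_energy_def by (rule Fubini') measurable
  also have "\<dots> = pair_energy M u B A"
    unfolding pair_energy_def
    by (intro nn_integral_cong) (simp add: power2_commute mult.assoc mult.commute[of "indicator A _"])
  finally show ?thesis .
qed

text \<open>Average \<open>(u x - u y)\<^sup>2 \<le> 2 (u x - u z)\<^sup>2 + 2 (u z - u y)\<^sup>2\<close> over the intermediate point \<open>z \<in> B\<close>.\<close>

lemma pair_energy_triangle:
  assumes [measurable]: "u \<in> borel_measurable M" "A \<in> sets M" "B \<in> sets M" "C \<in> sets M"
  shows "emeasure M B * pair_energy M u A C
    \<le> 2 * emeasure M C * pair_energy M u A B + 2 * emeasure M A * pair_energy M u B C"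
proof -
  interpret P: pair_sigma_finite M M by standard
  let ?q = "\<lambda>x y. ennreal ((u x - u y)\<^sup>2)"
  have pt: "indicator B z * (?q x y * indicator A x * indicator C y)
      \<le> 2 * (?q x z * indicator A x * indicator B z) * indicator C y
        + 2 * indicator A x * (?q z y * indicator B z * indicator C y)" for x y z
  proof -
    have "0 \<le> ((u x - u z) - (u z - u y))\<^sup>2" by simp
    then have "(u x - u y)\<^sup>2 \<le> 2 * (u x - u z)\<^sup>2 + 2 * (u z - u y)\<^sup>2"
      by (simp add: power2_eq_square algebra_simps)
    then have "?q x y \<le> ennreal (2 * (u x - u z)\<^sup>2 + 2 * (u z - u y)\<^sup>2)"
      by (rule ennreal_leI)
    then have "?q x y \<le> 2 * ?q x z + 2 * ?q z y"
      by (simp add: ennreal_plus ennreal_mult)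
    then show ?thesis by (simp split: split_indicator)
  qed
  have "emeasure M B * pair_energy M u A C
      = (\<integral>\<^sup>+z. indicator B z * pair_energy M u A C \<partial>M)"
    by (simp add: nn_integral_multc)
  also have "\<dots> = (\<integral>\<^sup>+z. \<integral>\<^sup>+x. \<integral>\<^sup>+y. indicator B z * (?q x y * indicator A x * indicator C y) \<partial>M \<partial>M \<partial>M)"
    unfolding pair_energy_def by (simp add: nn_integral_cmult)
  also have "\<dots> \<le> (\<integral>\<^sup>+z. \<integral>\<^sup>+x. \<integral>\<^sup>+y.
      2 * (?q x z * indicator A x * indicator B z) * indicator C y
        + 2 * indicator A x * (?q z y * indicator B z * indicator C y) \<partial>M \<partial>M \<partial>M)"
    by (intro nn_integral_mono pt)
  also have "\<dots> = (\<integral>\<^sup>+z. \<integral>\<^sup>+x. 2 * (?q x z * indicator A x * indicator B z) * emeasure M C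
        + 2 * indicator A x * (\<integral>\<^sup>+y. ?q z y * indicator B z * indicator C y \<partial>M) \<partial>M \<partial>M)"
    by (simp add: nn_integral_add nn_integral_cmult)
  also have "\<dots> = (\<integral>\<^sup>+z. 2 * (\<integral>\<^sup>+x. ?q x z * indicator A x * indicator B z \<partial>M) * emeasure M C
        + 2 * emeasure M A * (\<integral>\<^sup>+y. ?q z y * indicator B z * indicator C y \<partial>M) \<partial>M)"
    by (simp add: nn_integral_add nn_integral_cmult nn_integral_multc)
  also have "\<dots> = 2 * (\<integral>\<^sup>+z. \<integral>\<^sup>+x. ?q x z * indicator A x * indicator B z \<partial>M \<partial>M) * emeasure M C
        + 2 * emeasure M A * pair_energy M u B C"
    unfolding pair_energy_def by (simp add: nn_integral_add nn_integral_cmult nn_integral_multc)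
  also have "(\<integral>\<^sup>+z. \<integral>\<^sup>+x. ?q x z * indicator A x * indicator B z \<partial>M \<partial>M) = pair_energy M u A B"
    unfolding pair_energy_def by (rule P.Fubini'[symmetric]) measurable
  finally show ?thesis by (simp add: ac_simps)
qed

end

lemma near_controlled_sym:
  fixes \<mu> :: "'a::metric_space measure"
  assumes "finite_measure \<mu>" "A \<in> sets \<mu>" "B \<in> sets \<mu>" "near_controlled \<mu> m A B"
  shows "near_controlled \<mu> m B A"
  using assms(4) finite_measure.pair_energy_commute[OF assms(1) _ assms(2,3)]
  unfolding near_controlled_def by metis

text \<open>The middle set needs positive measure, because one divides by \<open>measure \<mu> B\<close> after averaging over it.\<close>

lemma near_controlled_trans:
  fixes \<mu> :: "'a::metric_space measure"
  assumes fin: "finite_measure \<mu>"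
    and sets: "A \<in> sets \<mu>" "B \<in> sets \<mu>" "C \<in> sets \<mu>" and B: "measure \<mu> B > 0"
    and AB: "near_controlled \<mu> m A B" and BC: "near_controlled \<mu> m B C"
  shows "near_controlled \<mu> m A C"
proof -
  interpret finite_measure \<mu> by (rule fin)
  obtain K where K: "K \<ge> 0" "\<And>u r. u \<in> borel_measurable \<mu> \<Longrightarrow> 0 < r \<Longrightarrow> r \<le> 1 \<Longrightarrow>
      pair_energy \<mu> u A B \<le> ennreal (K / r ^ m) * near_energy \<mu> u r"
    using AB unfolding near_controlled_def by blast
  obtain L where L: "L \<ge> 0" "\<And>u r. u \<in> borel_measurable \<mu> \<Longrightarrow> 0 < r \<Longrightarrow> r \<le> 1 \<Longrightarrow>
      pair_energy \<mu> u B C \<le> ennreal (L / r ^ m) * near_energy \<mu> u r"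
    using BC unfolding near_controlled_def by blast
  define a b c where "a = measure \<mu> A" and "b = measure \<mu> B" and "c = measure \<mu> C"
  have nonneg: "a \<ge> 0" "c \<ge> 0" "b > 0" using B by (auto simp: a_def b_def c_def)
  show ?thesis unfolding near_controlled_def
  proof (intro exI[of _ "(2 * c * K + 2 * a * L) / b"] conjI ballI allI impI)
    fix u :: "'a \<Rightarrow> real" and r :: real assume u: "u \<in> borel_measurable \<mu>" and r: "0 < r \<and> r \<le> (1::real)"
    have r': "0 < r" "r \<le> 1" using r by auto
    let ?N = "near_energy \<mu> u r" and ?E = "pair_energy \<mu> u A C"
    have "ennreal b * ?E \<le> 2 * ennreal c * pair_energy \<mu> u A B + 2 * ennreal a * pair_energy \<mu> u B C"
      using pair_energy_triangle[OF u sets] by (simp add: emeasure_eq_measure a_def b_def c_def)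
    also have "\<dots> \<le> 2 * ennreal c * (ennreal (K / r ^ m) * ?N) + 2 * ennreal a * (ennreal (L / r ^ m) * ?N)"
      by (intro add_mono mult_left_mono K L u r') auto
    also have "\<dots> = ennreal ((2 * c * K + 2 * a * L) / r ^ m) * ?N"
    proof -
      have "ennreal ((2 * c * K + 2 * a * L) / r ^ m)
          = 2 * ennreal c * ennreal (K / r ^ m) + 2 * ennreal a * ennreal (L / r ^ m)"
        using nonneg K(1) L(1) r'
        by (simp add: add_divide_distrib ennreal_mult[symmetric] ennreal_plus[symmetric]
            ennreal_numeral[symmetric] del: ennreal_plus ennreal_numeral)
      then show ?thesis by (simp add: distrib_right mult.assoc)
    qed
    finally have *: "ennreal b * ?E \<le> ennreal ((2 * c * K + 2 * a * L) / r ^ m) * ?N" .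
    have "?E = ennreal (1 / b) * (ennreal b * ?E)"
      using nonneg by (simp add: mult.assoc[symmetric] ennreal_mult[symmetric])
    also have "\<dots> \<le> ennreal (1 / b) * (ennreal ((2 * c * K + 2 * a * L) / r ^ m) * ?N)"
      by (intro mult_left_mono *) auto
    also have "\<dots> = ennreal ((2 * c * K + 2 * a * L) / b / r ^ m) * ?N"
      using nonneg K(1) L(1) r' by (simp add: mult.assoc[symmetric] ennreal_mult[symmetric])
    finally show "?E \<le> ennreal ((2 * c * K + 2 * a * L) / b / r ^ m) * ?N" .
  qed (use nonneg K L in auto)
qed

lemma near_controlled_finite_cover:
  fixes \<mu> :: "'a::metric_space measure"
  assumes "finite I" and ctrl: "\<And>i. i \<in> I \<Longrightarrow> near_controlled \<mu> m (A i) (B i)"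
    and fin: "finite_measure \<mu>"
    and sets: "\<And>i. i \<in> I \<Longrightarrow> A i \<in> sets \<mu> \<and> B i \<in> sets \<mu>"
    and cover: "S \<times> T \<subseteq> (\<Union>i\<in>I. A i \<times> B i)"
  shows "near_controlled \<mu> m S T"
proof -
  interpret finite_measure \<mu> by fact
  obtain K where K: "\<And>i. i \<in> I \<Longrightarrow> K i \<ge> 0"
      "\<And>i u r. i \<in> I \<Longrightarrow> u \<in> borel_measurable \<mu> \<Longrightarrow> 0 < r \<Longrightarrow> r \<le> 1 \<Longrightarrow>
      pair_energy \<mu> u (A i) (B i) \<le> ennreal (K i / r ^ m) * near_energy \<mu> u r"
    using ctrl unfolding near_controlled_def by metis
  show ?thesis unfolding near_controlled_def
  proof (intro exI[of _ "sum K I"] conjI ballI allI impI)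
    fix u :: "'a \<Rightarrow> real" and r :: real assume u[measurable]: "u \<in> borel_measurable \<mu>" and r: "0 < r \<and> r \<le> (1::real)"
    have [measurable]: "i \<in> I \<Longrightarrow> A i \<in> sets \<mu>" "i \<in> I \<Longrightarrow> B i \<in> sets \<mu>" for i using sets by auto
    have pt: "ennreal ((u x - u y)\<^sup>2) * indicator S x * indicator T y
        \<le> (\<Sum>i\<in>I. ennreal ((u x - u y)\<^sup>2) * indicator (A i) x * indicator (B i) y)" for x y
    proof (cases "x \<in> S \<and> y \<in> T")
      case True
      then obtain i where "i \<in> I" "x \<in> A i" "y \<in> B i" using cover by blast
      then show ?thesis
        using member_le_sum[of i I "\<lambda>i. ennreal ((u x - u y)\<^sup>2) * indicator (A i) x * indicator (B i) y"]
          True \<open>finite I\<close> by simp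
    qed auto
    have "pair_energy \<mu> u S T \<le> (\<integral>\<^sup>+x. \<integral>\<^sup>+y. (\<Sum>i\<in>I. ennreal ((u x - u y)\<^sup>2) * indicator (A i) x * indicator (B i) y) \<partial>\<mu> \<partial>\<mu>)"
      unfolding pair_energy_def by (intro nn_integral_mono pt)
    also have "\<dots> = (\<Sum>i\<in>I. pair_energy \<mu> u (A i) (B i))"
      unfolding pair_energy_def by (simp add: nn_integral_sum)
    also have "\<dots> \<le> (\<Sum>i\<in>I. ennreal (K i / r ^ m) * near_energy \<mu> u r)"
      using K r u by (intro sum_mono) auto
    also have "\<dots> = ennreal (sum K I / r ^ m) * near_energy \<mu> u r"
      using K r by (simp add: sum_distrib_right[symmetric] sum_divide_distrib)
    finally show "pair_energy \<mu> u S T \<le> ennreal (sum K I / r ^ m) * near_energy \<mu> u r" .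
  qed (use K in \<open>auto intro: sum_nonneg\<close>)
qed

text \<open>For points \<open>x\<close> and \<open>y\<close>, having neighbourhoods \<open>A\<close> and \<open>B\<close> with controlled energy over \<open>A \<times> B\<close> is an
  equivalence relation with open classes: transitivity works because two neighbourhoods of the middle
  point meet in a nonempty open set, which has positive measure. Connectedness makes all points
  equivalent, and compactness of \<open>M \<times> M\<close> leaves finitely many constants. Arbitrarily small
  neighbourhoods \<open>U \<subseteq> V\<close> enter only to give every nonempty open set \<open>V\<close> positive measure.\<close>

lemma near_controlled_globalize:
  fixes \<mu> :: "'a::metric_space measure"
  assumes M: "compact M" "connected M" and sets_\<mu>: "sets \<mu> = sets (restrict_space borel M)"
    and loc: "\<And>V y. openin (top_of_set M) V \<Longrightarrow> y \<in> V \<Longrightarrow> \<exists>U. openin (top_of_set M) U \<and> y \<in> U \<and> U \<subseteq> V \<and>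
        0 < emeasure \<mu> U \<and> emeasure \<mu> U < \<infinity> \<and> near_controlled \<mu> m U U"
  shows "finite_measure \<mu>" and "near_controlled \<mu> m M M"
proof -
  have space_\<mu>: "space \<mu> = M"
    using sets_eq_imp_space_eq[OF sets_\<mu>] by (simp add: space_restrict_space)
  have open_sets: "V \<in> sets \<mu>" if "openin (top_of_set M) V" for V
  proof -
    obtain T where "open T" "V = M \<inter> T" using \<open>openin (top_of_set M) V\<close> by (auto simp: openin_open)
    then show ?thesis by (auto simp: sets_\<mu> sets_restrict_space)
  qed
  have open_M: "openin (top_of_set M) M" by simp
  have "\<forall>y\<in>M. \<exists>U. openin (top_of_set M) U \<and> y \<in> U \<and> emeasure \<mu> U < \<infinity> \<and> near_controlled \<mu> m U U"
    using loc[OF open_M] by blast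
  then obtain U where U: "\<And>y. y \<in> M \<Longrightarrow> openin (top_of_set M) (U y)" "\<And>y. y \<in> M \<Longrightarrow> y \<in> U y"
      "\<And>y. y \<in> M \<Longrightarrow> emeasure \<mu> (U y) < \<infinity>" "\<And>y. y \<in> M \<Longrightarrow> near_controlled \<mu> m (U y) (U y)"
    by metis
  have "\<forall>y\<in>M. \<exists>T. open T \<and> U y = M \<inter> T" using U(1) by (auto simp: openin_open)
  then obtain O' where O': "\<And>y. y \<in> M \<Longrightarrow> open (O' y)" "\<And>y. y \<in> M \<Longrightarrow> U y = M \<inter> O' y" by metis
  have "M \<subseteq> (\<Union>y\<in>M. O' y)" using U(2) O'(2) by blast
  then obtain F where F: "F \<subseteq> M" "finite F" "M \<subseteq> (\<Union>y\<in>F. O' y)"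
    using compactE_image[OF M(1), of M O'] O'(1) by metis
  show fin: "finite_measure \<mu>"
  proof (rule finite_measureI)
    have "M = (\<Union>y\<in>F. U y)" using F O'(2) by blast
    then have "emeasure \<mu> M \<le> (\<Sum>y\<in>F. emeasure \<mu> (U y))"
      using emeasure_subadditive_finite[of F U \<mu>] F(1,2) U(1) open_sets by auto
    also have "\<dots> < \<infinity>" using F(1,2) U(3) by (auto simp: less_top[symmetric])
    finally show "emeasure \<mu> (space \<mu>) \<noteq> \<infinity>" by (simp add: space_\<mu>)
  qed
  interpret finite_measure \<mu> by (rule fin)
  have pos: "0 < measure \<mu> V" if V: "openin (top_of_set M) V" "V \<noteq> {}" for V
  proof -
    obtain y where "y \<in> V" using V by blast
    then obtain W where W: "openin (top_of_set M) W" "W \<subseteq> V" "0 < emeasure \<mu> W"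
      using loc[OF V(1)] by blast
    have "emeasure \<mu> W \<le> emeasure \<mu> V"
      using W(2) open_sets[OF V(1)] by (rule emeasure_mono)
    then show ?thesis using W(3) by (simp add: emeasure_eq_measure)
  qed
  define Q where "Q x y \<longleftrightarrow> (\<exists>A B. openin (top_of_set M) A \<and> openin (top_of_set M) B \<and> x \<in> A \<and> y \<in> B
      \<and> near_controlled \<mu> m A B)" for x y
  have Q: "Q x y" if "x \<in> M" "y \<in> M" for x y
  proof (rule connected_equivalence_relation[OF M(2) that])
    show "Q y x" if "Q x y" for x y
      using that near_controlled_sym[OF fin] open_sets unfolding Q_def by metis
    show "Q x z" if "Q x y" "Q y z" for x y z
    proof -
      obtain A B where AB: "openin (top_of_set M) A" "openin (top_of_set M) B" "x \<in> A" "y \<in> B"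
          "near_controlled \<mu> m A B"
        using \<open>Q x y\<close> unfolding Q_def by blast
      obtain B' C where BC: "openin (top_of_set M) B'" "openin (top_of_set M) C" "y \<in> B'" "z \<in> C"
          "near_controlled \<mu> m B' C"
        using \<open>Q y z\<close> unfolding Q_def by blast
      have op: "openin (top_of_set M) (B \<inter> B')" using AB BC by blast
      have "near_controlled \<mu> m A C"
      proof (rule near_controlled_trans[OF fin])
        show "near_controlled \<mu> m A (B \<inter> B')" "near_controlled \<mu> m (B \<inter> B') C"
          using near_controlled_mono[OF AB(5)] near_controlled_mono[OF BC(5)] by auto
        show "0 < measure \<mu> (B \<inter> B')" using pos[OF op] AB BC by blast
      qed (use open_sets AB BC op in auto)
      then show ?thesis using AB BC unfolding Q_def by blast
    qed
    show "\<exists>T. openin (top_of_set M) T \<and> a \<in> T \<and> (\<forall>x\<in>T. Q a x)" if "a \<in> M" for a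
      using U[OF that] unfolding Q_def by blast
  qed
  have "\<forall>z\<in>M \<times> M. \<exists>A B. openin (top_of_set M) A \<and> openin (top_of_set M) B \<and> z \<in> A \<times> B \<and> near_controlled \<mu> m A B"
    using Q unfolding Q_def by (auto simp: mem_Times_iff)
  then obtain A B where AB: "\<And>z. z \<in> M \<times> M \<Longrightarrow> openin (top_of_set M) (A z) \<and> openin (top_of_set M) (B z)
      \<and> z \<in> A z \<times> B z \<and> near_controlled \<mu> m (A z) (B z)"
    by metis
  then have "\<forall>z\<in>M \<times> M. \<exists>S T. open S \<and> open T \<and> A z = M \<inter> S \<and> B z = M \<inter> T" by (meson openin_open)
  then obtain S T where ST: "\<And>z. z \<in> M \<times> M \<Longrightarrow> open (S z) \<and> open (T z) \<and> A z = M \<inter> S z \<and> B z = M \<inter> T z"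
    by metis
  have "open (S z \<times> T z)" if "z \<in> M \<times> M" for z using ST[OF that] by (simp add: open_Times)
  moreover have "M \<times> M \<subseteq> (\<Union>z\<in>M \<times> M. S z \<times> T z)" using AB ST by blast
  ultimately obtain Z where Z: "Z \<subseteq> M \<times> M" "finite Z" "M \<times> M \<subseteq> (\<Union>z\<in>Z. S z \<times> T z)"
    by (rule compactE_image[OF compact_Times[OF M(1) M(1)]])
  show "near_controlled \<mu> m M M"
  proof (rule near_controlled_finite_cover[OF Z(2) _ fin])
    show "near_controlled \<mu> m (A z) (B z)" if "z \<in> Z" for z using AB Z(1) that by blast
    show "A z \<in> sets \<mu> \<and> B z \<in> sets \<mu>" if "z \<in> Z" for z using AB Z(1) that open_sets by blast
    show "M \<times> M \<subseteq> (\<Union>z\<in>Z. A z \<times> B z)"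
    proof
      fix w assume w: "w \<in> M \<times> M"
      then obtain z where "z \<in> Z" "w \<in> S z \<times> T z" using Z(3) by blast
      then show "w \<in> (\<Union>z\<in>Z. A z \<times> B z)" using ST[of z] w Z(1) by auto
    qed
  qed
qed

section \<open>Immersions and their volume densities\<close>

lemma continuous_on_det:
  fixes A :: "'a::topological_space \<Rightarrow> real^'n^'n"
  assumes "\<And>i j. continuous_on S (\<lambda>x. A x $ i $ j)"
  shows "continuous_on S (\<lambda>x. det (A x))"
  unfolding det_def by (intro continuous_intros assms)

lemma inner_gram_matrix:
  fixes J :: "real^'k^'d"
  shows "x \<bullet> ((transpose J ** J) *v x) = (J *v x) \<bullet> (J *v x)"
  by (metis dot_lmul_matrix matrix_vector_mul_assoc transpose_matrix_vector transpose_transpose inner_commute)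

text \<open>The Gram matrix is positive definite, and so is every matrix on the segment joining it to the identity.
  None of them is singular, so the determinant keeps the sign it has at the identity.\<close>

lemma det_gram_pos:
  fixes J :: "real^'k^'d"
  assumes inj: "inj ((*v) J)"
  shows "det (transpose J ** J) > 0"
proof (rule ccontr)
  define A where "A s = (\<chi> i j. (1 - s) * (mat 1 :: real^'k^'k) $ i $ j + s * (transpose J ** J) $ i $ j)" for s :: real
  have A_mult: "A s *v x = (1 - s) *\<^sub>R x + s *\<^sub>R ((transpose J ** J) *v x)" for s x
  proof -
    have "A s = (1 - s) *\<^sub>R mat 1 + s *\<^sub>R (transpose J ** J)"
      by (simp add: A_def vec_eq_iff)
    then show ?thesis
      by (simp add: matrix_vector_mult_add_rdistrib scaleR_matrix_vector_assoc[symmetric])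
  qed
  have nz: "det (A s) \<noteq> 0" if s: "0 \<le> s" "s \<le> 1" for s
  proof -
    have "x = 0" if "A s *v x = 0" for x
    proof (rule ccontr)
      assume x: "x \<noteq> 0"
      have "J *v x \<noteq> 0"
        using x inj by (metis injD matrix_vector_mult_0_right)
      then have pos: "x \<bullet> x > 0" "(J *v x) \<bullet> (J *v x) > 0" using x by auto
      have "0 = x \<bullet> (A s *v x)" using that by simp
      also have "\<dots> = (1 - s) * (x \<bullet> x) + s * ((J *v x) \<bullet> (J *v x))"
        unfolding A_mult by (simp add: inner_add_right inner_gram_matrix)
      also have "\<dots> > 0"
      proof (cases "s = 0")
        case False
        then show ?thesis using s pos by (intro add_nonneg_pos mult_nonneg_nonneg mult_pos_pos) auto
      qed (use pos in auto)
      finally show False by simp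
    qed
    then have "invertible (A s)"
      unfolding invertible_left_inverse matrix_left_invertible_ker by blast
    then show ?thesis by (simp add: invertible_det_nz)
  qed
  assume "\<not> det (transpose J ** J) > 0"
  moreover have "A 0 = mat 1" "A 1 = transpose J ** J" by (simp_all add: A_def vec_eq_iff)
  ultimately have "det (A 1) \<le> 0" "0 \<le> det (A 0)" by auto
  moreover have "continuous_on {0..1} (\<lambda>s. det (A s))"
    by (rule continuous_on_det) (simp add: A_def, intro continuous_intros)
  ultimately obtain s where "0 \<le> s" "s \<le> 1" "det (A s) = 0"
    using IVT2'[of "\<lambda>s. det (A s)" 1 0 0] by auto
  then show False using nz by blast
qed

lemma smooth_on_has_derivative:
  assumes "smooth_on \<phi> W" "x \<in> W"
  shows "(\<phi> has_derivative frechet_derivative \<phi> (at x)) (at x)"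
  using assms unfolding smooth_on_def by (metis C_on.simps(2) frechet_derivative_works)

lemma smooth_on_continuous_derivative:
  assumes "smooth_on \<phi> W"
  shows "continuous_on W (\<lambda>x. frechet_derivative \<phi> (at x) v)"
proof -
  have "C_on 1 \<phi> W" using assms unfolding smooth_on_def by blast
  then show ?thesis by simp
qed

lemma smooth_on_continuous:
  assumes "smooth_on \<phi> W"
  shows "continuous_on W \<phi>"
  using assms unfolding smooth_on_def by (metis C_on.simps(1))

lemma smooth_on_linear_derivative:
  assumes "smooth_on \<phi> W" "x \<in> W"
  shows "linear (frechet_derivative \<phi> (at x))"
  using smooth_on_has_derivative[OF assms] has_derivative_linear by blast

lemma continuous_on_volume_density:
  assumes "smooth_on \<phi> W"
  shows "continuous_on W (volume_density \<phi>)"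
proof -
  have "continuous_on W (\<lambda>x. det (transpose (matrix (frechet_derivative \<phi> (at x))) ** matrix (frechet_derivative \<phi> (at x))))"
    by (rule continuous_on_det)
       (simp add: matrix_matrix_mult_def transpose_def matrix_def,
        intro continuous_intros smooth_on_continuous_derivative assms)
  then show ?thesis unfolding volume_density_def[abs_def] Let_def by (intro continuous_intros)
qed

lemma volume_density_pos:
  assumes "smooth_on \<phi> W" "x \<in> W" "inj (frechet_derivative \<phi> (at x))"
  shows "volume_density \<phi> x > 0"
proof -
  have "(*v) (matrix (frechet_derivative \<phi> (at x))) = frechet_derivative \<phi> (at x)"
    using smooth_on_linear_derivative[OF assms(1,2)] by (simp add: fun_eq_iff matrix_works)
  then show ?thesis
    unfolding volume_density_def Let_def using assms(3) by (simp add: det_gram_pos)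
qed

text \<open>If \<open>f \<circ> g = h\<close> near \<open>x\<close>, where \<open>f\<close> has an injective derivative at \<open>g x\<close> with left inverse \<open>P\<close>, then
  the continuity of \<open>g\<close> improves to differentiability. The map \<open>F = P \<circ> f\<close> has the identity as its
  derivative at \<open>g x\<close>, so \<open>g y - g x\<close> equals \<open>F (g y) - F (g x) = P (h y) - P (h x)\<close> up to an error that is small
  compared to \<open>norm (g y - g x)\<close>. With relative error \<open>1/2\<close> this gives a Lipschitz bound for \<open>g\<close>
  at \<open>x\<close>; the error is then small compared to \<open>norm (y - x)\<close> as well.\<close>

lemma differentiable_through_immersion:
  fixes f :: "'a::real_normed_vector \<Rightarrow> 'b::real_normed_vector" and g :: "'c::real_normed_vector \<Rightarrow> 'a"
  assumes df: "(f has_derivative f') (at (g x))" and P: "bounded_linear P" "\<And>v. P (f' v) = v"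
    and g: "isCont g x" and dh: "(h has_derivative h') (at x)"
    and fg: "eventually (\<lambda>y. f (g y) = h y) (at x)" and fgx: "f (g x) = h x"
  shows "(g has_derivative P \<circ> h') (at x)"
proof -
  interpret P: bounded_linear P by fact
  interpret h': bounded_linear h' using dh by (rule has_derivative_bounded_linear)
  define F where "F y = P (f y)" for y
  define G where "G y = P (h y)" for y
  define G' where "G' v = P (h' v)" for v
  have dF: "(F has_derivative (\<lambda>v. v)) (at (g x))"
    using P.has_derivative[OF df] unfolding F_def P(2) .
  have dG: "(G has_derivative G') (at x)"
    unfolding G_def G'_def by (rule P.has_derivative[OF dh])
  interpret G': bounded_linear G' using dG by (rule has_derivative_bounded_linear)
  have FG: "eventually (\<lambda>y. F (g y) = G y) (nhds x)"
    using fg fgx unfolding eventually_nhds_conv_at F_def G_def by (auto elim: eventually_mono)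
  have gx: "filterlim g (nhds (g x)) (nhds x)"
    using g by (simp add: isCont_def tendsto_at_iff_tendsto_nhds)
  \<comment> \<open>The error of linearising \<open>F\<close> at \<open>g x\<close>, transported to the parameter \<open>y\<close> of \<open>g\<close>.\<close>
  have err: "eventually (\<lambda>y. norm ((G y - G x) - (g y - g x)) \<le> e * norm (g y - g x)) (nhds x)"
    if "e > 0" for e
  proof -
    have "eventually (\<lambda>z. norm (F z - F (g x) - (z - g x)) \<le> e * norm (z - g x)) (nhds (g x))"
      using dF \<open>e > 0\<close> unfolding has_derivative_at_alt eventually_nhds_metric
      by (auto simp: dist_norm)
    then have "eventually (\<lambda>y. norm (F (g y) - F (g x) - (g y - g x)) \<le> e * norm (g y - g x)) (nhds x)"
      by (rule eventually_compose_filterlim[OF _ gx])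
    then show ?thesis
      using FG by eventually_elim (use eventually_nhds_x_imp_x[OF FG] in simp)
  qed
  have errG: "eventually (\<lambda>y. norm (G y - G x - G' (y - x)) \<le> e * norm (y - x)) (nhds x)"
    if "e > 0" for e
    using dG \<open>e > 0\<close> unfolding has_derivative_at_alt eventually_nhds_metric by (auto simp: dist_norm)
  obtain K where K: "K > 0" "\<And>v. norm (G' v) \<le> norm v * K" using G'.pos_bounded by blast
  have lip: "eventually (\<lambda>y. norm (g y - g x) \<le> 2 * (K + 1) * norm (y - x)) (nhds x)"
  proof -
    have "eventually (\<lambda>y. norm ((G y - G x) - (g y - g x)) \<le> 1/2 * norm (g y - g x)) (nhds x)"
      by (rule err) simp
    moreover have "eventually (\<lambda>y. norm (G y - G x - G' (y - x)) \<le> 1 * norm (y - x)) (nhds x)"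
      by (rule errG) simp
    ultimately show ?thesis
    proof eventually_elim
      case (elim y)
      have "norm (g y - g x) \<le> norm (G y - G x) + norm ((G y - G x) - (g y - g x))"
        by (metis norm_triangle_sub norm_minus_commute)
      moreover have "norm (G y - G x) \<le> norm (G' (y - x)) + norm (G y - G x - G' (y - x))"
        by (rule norm_triangle_sub)
      moreover have "norm (G' (y - x)) \<le> norm (y - x) * K" by (rule K)
      ultimately show ?case using elim by (simp add: algebra_simps)
    qed
  qed
  have "eventually (\<lambda>y. norm (g y - g x - G' (y - x)) \<le> e * norm (y - x)) (nhds x)" if e: "e > 0" for e
  proof -
    define e' where "e' = e / (2 * (2 * (K + 1)))"
    have "e' > 0" using e K(1) by (simp add: e'_def)
    have "eventually (\<lambda>y. norm (G y - G x - G' (y - x)) \<le> e / 2 * norm (y - x)) (nhds x)"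
      by (rule errG) (use e in simp)
    with err[OF \<open>e' > 0\<close>] lip show ?thesis
    proof eventually_elim
      case (elim y)
      have "e' * norm (g y - g x) \<le> e' * (2 * (K + 1) * norm (y - x))"
        using elim(2) \<open>e' > 0\<close> by (intro mult_left_mono) auto
      also have "\<dots> = e / 2 * norm (y - x)"
        using K(1) unfolding e'_def by (simp add: field_simps)
      finally have "norm ((G y - G x) - (g y - g x)) \<le> e / 2 * norm (y - x)" using elim(1) by simp
      moreover have "g y - g x - G' (y - x) = (G y - G x - G' (y - x)) - ((G y - G x) - (g y - g x))"
        by simp
      ultimately show ?case
        using elim(3) norm_triangle_ineq4[of "G y - G x - G' (y - x)" "(G y - G x) - (g y - g x)"]
        by (simp add: field_simps)
    qed
  qed
  then have "(g has_derivative G') (at x)"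
    unfolding has_derivative_at_alt eventually_nhds_metric
    using G'.bounded_linear_axioms by (auto simp: dist_norm)
  then show ?thesis by (simp add: G'_def[abs_def] comp_def)
qed

text \<open>The Gram matrix of \<open>J T\<close> is \<open>T\<^sup>T (J\<^sup>T J) T\<close>, and the determinant is multiplicative.\<close>

lemma volume_density_transform:
  fixes \<phi> :: "real^'k \<Rightarrow> real^'d" and \<phi>' :: "real^'k \<Rightarrow> real^'d"
  assumes "linear T" "linear (frechet_derivative \<phi> (at y))"
    and "frechet_derivative \<phi>' (at x) = frechet_derivative \<phi> (at y) \<circ> T"
  shows "volume_density \<phi>' x = \<bar>det (matrix T)\<bar> * volume_density \<phi> y"
proof -
  let ?J = "matrix (frechet_derivative \<phi> (at y))" and ?T = "matrix T"
  have "matrix (frechet_derivative \<phi>' (at x)) = ?J ** ?T"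
    using assms by (simp add: matrix_compose)
  then have "transpose (matrix (frechet_derivative \<phi>' (at x))) ** matrix (frechet_derivative \<phi>' (at x))
      = transpose ?T ** ((transpose ?J ** ?J) ** ?T)"
    by (simp add: matrix_transpose_mul matrix_mul_assoc)
  then show ?thesis
    unfolding volume_density_def Let_def
    by (simp add: det_mul real_sqrt_mult)
qed

section \<open>Independence of the chart volume from the chart\<close>

lemma C_on_subset_domain: "C_on n f W \<Longrightarrow> N \<subseteq> W \<Longrightarrow> C_on n f N"
  by (induction n arbitrary: f) (auto intro: continuous_on_subset)

lemma smooth_on_subset: "smooth_on f W \<Longrightarrow> N \<subseteq> W \<Longrightarrow> smooth_on f N"
  unfolding smooth_on_def using C_on_subset_domain by blast

text \<open>The change of variables theorem for absolutely integrable functions, turned into an inequality of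
  Lebesgue integrals with values in \<open>[0, \<infinity>]\<close>. An inequality suffices below, and it holds
  trivially when the right-hand side is infinite.\<close>

lemma nn_integral_change_of_variables_le:
  fixes f :: "real^'m::{finite,wellorder} \<Rightarrow> real" and g :: "real^'m::_ \<Rightarrow> real^'m::_"
  assumes f[measurable]: "f \<in> borel_measurable borel" and nonneg: "\<And>y. y \<in> T \<Longrightarrow> 0 \<le> f y"
    and S: "S \<in> sets lebesgue" and T[measurable]: "T \<in> sets borel" and gST: "g ` S \<subseteq> T"
    and der: "\<And>x. x \<in> S \<Longrightarrow> (g has_derivative g' x) (at x within S)" and inj: "inj_on g S"
  shows "(\<integral>\<^sup>+x. ennreal (\<bar>det (matrix (g' x))\<bar> * f (g x)) * indicator S x \<partial>lborel)
       \<le> (\<integral>\<^sup>+y. ennreal (f y) * indicator T y \<partial>lborel)" (is "?L \<le> ?R")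
proof (cases "?R < \<infinity>")
  case True
  \<comment> \<open>The theorem on change of variables is about vector-valued functions; scalars are treated as vectors of dimension one.\<close>
  let ?f = "\<lambda>y. vec (f y) :: real^1"
  have "integrable lborel (\<lambda>y. indicator T y *\<^sub>R f y)"
  proof (rule integrableI_bounded)
    have "(\<integral>\<^sup>+y. ennreal (norm (indicator T y *\<^sub>R f y)) \<partial>lborel) = ?R"
      by (intro nn_integral_cong) (use nonneg in \<open>auto split: split_indicator\<close>)
    then show "(\<integral>\<^sup>+y. ennreal (norm (indicator T y *\<^sub>R f y)) \<partial>lborel) < \<infinity>" using True by simp
  qed simp
  then have fT: "f absolutely_integrable_on T"
    unfolding set_integrable_def by (subst integrable_completion) auto
  have gS: "g ` S \<in> sets lebesgue"
    using S der by (intro differentiable_image_in_sets_lebesgue) (auto simp: differentiable_on_def differentiable_def)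
  have fgS: "f absolutely_integrable_on g ` S"
    by (rule set_integrable_subset[OF fT gS gST])
  then have "?f absolutely_integrable_on g ` S"
    by (simp add: absolutely_integrable_on_1_iff)
  then have cov: "(\<lambda>x. \<bar>det (matrix (g' x))\<bar> *\<^sub>R ?f (g x)) absolutely_integrable_on S"
      "integral S (\<lambda>x. \<bar>det (matrix (g' x))\<bar> *\<^sub>R ?f (g x)) = integral (g ` S) ?f"
    using has_absolute_integral_change_of_variables[OF S der inj, of ?f] by blast+
  have gf: "(\<lambda>x. \<bar>det (matrix (g' x))\<bar> * f (g x)) absolutely_integrable_on S"
    using cov(1) by (simp add: absolutely_integrable_on_1_iff)
  have eq: "integral S (\<lambda>x. \<bar>det (matrix (g' x))\<bar> * f (g x)) = integral (g ` S) f"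
    using arg_cong[OF cov(2), of "\<lambda>v. v $ 1"] by (simp add: integral_on_1_eq)
  have "?L = ennreal (integral S (\<lambda>x. \<bar>det (matrix (g' x))\<bar> * f (g x)))"
    using set_lebesgue_integral_eq_integral(1)[OF gf] nonneg gST
    by (intro nn_integral_has_integral_lebesgue') (auto simp: integrable_integral)
  also have "\<dots> \<le> ennreal (integral T f)"
    unfolding eq
    using set_lebesgue_integral_eq_integral(1)[OF fgS] set_lebesgue_integral_eq_integral(1)[OF fT] nonneg gST
    by (intro ennreal_leI integral_subset_le) auto
  also have "\<dots> = ?R"
    using set_lebesgue_integral_eq_integral(1)[OF fT] nonneg
    by (intro nn_integral_has_integral_lebesgue'[symmetric]) (auto simp: integrable_integral)
  finally show ?thesis .
qed (simp add: not_less top_unique)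

lemma closed_half_space: "closed (half_space i)"
  unfolding half_space_def by (intro closed_Collect_le continuous_intros)

lemma half_space_borel[measurable]: "half_space i \<in> sets borel"
  using closed_half_space by (rule borel_closed)

lemma local_parametrizationD:
  assumes "local_parametrization M i W \<phi>"
  shows "open W" "smooth_on \<phi> W"
    and "\<And>x. x \<in> W \<inter> half_space i \<Longrightarrow> inj (frechet_derivative \<phi> (at x))"
    and "openin (top_of_set M) (\<phi> ` (W \<inter> half_space i))"
    and "\<exists>\<psi>. homeomorphism (W \<inter> half_space i) (\<phi> ` (W \<inter> half_space i)) \<phi> \<psi>"
    and "\<And>x. x \<in> W \<Longrightarrow> x \<in> half_space i \<Longrightarrow> \<phi> x \<in> M"
  using assms openin_imp_subset unfolding local_parametrization_def by blast+

lemma openin_imp_restrict_borel: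
  assumes "openin (top_of_set M) V"
  shows "V \<in> sets (restrict_space borel M)"
proof -
  obtain T where "open T" "V = M \<inter> T" using assms by (auto simp: openin_open)
  then show ?thesis by (auto simp: sets_restrict_space)
qed

lemma chart_preimage_borel:
  assumes \<phi>: "local_parametrization M i W \<phi>" and Y: "Y \<in> sets (restrict_space borel M)"
  shows "W \<inter> half_space i \<inter> \<phi> -` Y \<in> sets borel"
proof -
  have D[measurable]: "W \<inter> half_space i \<in> sets borel"
    using local_parametrizationD(1)[OF \<phi>] by simp
  have "continuous_on (W \<inter> half_space i) \<phi>"
    using smooth_on_continuous[OF local_parametrizationD(2)[OF \<phi>]] continuous_on_subset by blast
  then have m: "\<phi> \<in> borel_measurable (restrict_space borel (W \<inter> half_space i))"
    by (rule borel_measurable_continuous_on_restrict)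
  obtain B where B: "B \<in> sets borel" "Y = M \<inter> B" using Y by (auto simp: sets_restrict_space)
  have "\<phi> -` B \<inter> (W \<inter> half_space i) \<in> sets (restrict_space borel (W \<inter> half_space i))"
    using measurable_sets[OF m B(1)] by (simp add: space_restrict_space)
  then have "\<phi> -` B \<inter> (W \<inter> half_space i) \<in> sets borel"
    using sets_restrict_space_iff[of "W \<inter> half_space i" borel] D by auto
  moreover have "W \<inter> half_space i \<inter> \<phi> -` Y = \<phi> -` B \<inter> (W \<inter> half_space i)"
    using local_parametrizationD(6)[OF \<phi>] B by auto
  ultimately show ?thesis by simp
qed

lemma chart_volume_measurable:
  assumes \<phi>: "local_parametrization M i W \<phi>"
  shows "\<phi> \<in> measurable (restrict_space borel (W \<inter> half_space i)) (restrict_space borel M)"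
    and "(\<lambda>x. volume_density \<phi> x * indicator (W \<inter> half_space i) x) \<in> borel_measurable borel"
proof -
  have D: "W \<inter> half_space i \<in> sets borel"
    using local_parametrizationD(1)[OF \<phi>] by simp
  have "continuous_on (W \<inter> half_space i) \<phi>"
    using smooth_on_continuous[OF local_parametrizationD(2)[OF \<phi>]] continuous_on_subset by blast
  then show "\<phi> \<in> measurable (restrict_space borel (W \<inter> half_space i)) (restrict_space borel M)"
    using local_parametrizationD(6)[OF \<phi>]
    by (intro measurable_restrict_space2 borel_measurable_continuous_on_restrict) (auto simp: space_restrict_space)
  have "continuous_on (W \<inter> half_space i) (volume_density \<phi>)"
    using continuous_on_volume_density[OF local_parametrizationD(2)[OF \<phi>]] continuous_on_subset by blast
  from borel_measurable_continuous_on_indicator[OF D this]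
  show "(\<lambda>x. volume_density \<phi> x * indicator (W \<inter> half_space i) x) \<in> borel_measurable borel"
    by (simp add: mult.commute)
qed

lemma sets_chart_volume[simp]: "sets (chart_volume M i W \<phi>) = sets (restrict_space borel M)"
  by (simp add: chart_volume_def)

lemma nn_integral_chart_volume:
  assumes \<phi>: "local_parametrization M i W \<phi>" and F[measurable]: "F \<in> borel_measurable (restrict_space borel M)"
  shows "(\<integral>\<^sup>+y. F y \<partial>chart_volume M i W \<phi>)
    = (\<integral>\<^sup>+x. ennreal (volume_density \<phi> x) * F (\<phi> x) * indicator (W \<inter> half_space i) x \<partial>lborel)"
proof -
  let ?D = "W \<inter> half_space i"
  have D: "?D \<in> sets borel" using local_parametrizationD(1)[OF \<phi>] by simp
  have [measurable_cong]: "sets (restrict_space lborel ?D) = sets (restrict_space borel ?D)"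
    by (simp add: sets_restrict_space)
  note chart_volume_measurable(1)[OF \<phi>, measurable]
  have [measurable]: "(\<lambda>x. ennreal (volume_density \<phi> x)) \<in> borel_measurable (restrict_space borel ?D)"
    using continuous_on_volume_density[OF local_parametrizationD(2)[OF \<phi>]] continuous_on_subset
    by (intro measurable_compose[OF _ measurable_ennreal] borel_measurable_continuous_on_restrict) blast
  have "(\<integral>\<^sup>+y. F y \<partial>chart_volume M i W \<phi>)
      = (\<integral>\<^sup>+x. ennreal (volume_density \<phi> x) * F (\<phi> x) \<partial>restrict_space lborel ?D)"
    unfolding chart_volume_def by (simp add: nn_integral_distr nn_integral_density)
  also have "\<dots> = (\<integral>\<^sup>+x. ennreal (volume_density \<phi> x) * F (\<phi> x) * indicator ?D x \<partial>lborel)"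
    using D by (subst nn_integral_restrict_space) auto
  finally show ?thesis .
qed

lemma emeasure_chart_volume:
  assumes \<phi>: "local_parametrization M i W \<phi>" and Y: "Y \<in> sets (restrict_space borel M)"
  shows "emeasure (chart_volume M i W \<phi>) Y
    = (\<integral>\<^sup>+x. ennreal (volume_density \<phi> x) * indicator (W \<inter> half_space i \<inter> \<phi> -` Y) x \<partial>lborel)"
proof -
  have "emeasure (chart_volume M i W \<phi>) Y = (\<integral>\<^sup>+y. indicator Y y \<partial>chart_volume M i W \<phi>)"
    using Y by simp
  also have "\<dots> = (\<integral>\<^sup>+x. ennreal (volume_density \<phi> x) * indicator (W \<inter> half_space i \<inter> \<phi> -` Y) x \<partial>lborel)"
    using Y by (subst nn_integral_chart_volume[OF \<phi>]) (auto intro!: nn_integral_cong split: split_indicator)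
  finally show ?thesis .
qed

text \<open>On an open set \<open>N\<close> of interior parameters the transition map \<open>\<psi> \<circ> \<phi>'\<close> is a continuous solution of
  \<open>\<phi> (\<tau> x) = \<phi>' x\<close>, hence differentiable since \<open>\<phi>\<close> is an immersion. Because \<open>\<phi>\<close> is smooth
  on the open set \<open>W\<close>, this is also true where \<open>\<tau> x\<close> lies on the boundary of the half-space of \<open>\<phi>\<close>. The
  chain rule then relates the derivatives of \<open>\<phi>\<close> and \<open>\<phi>'\<close>.\<close>

lemma transition_map_derivative:
  assumes \<phi>: "local_parametrization M i W \<phi>" and \<psi>: "homeomorphism (W \<inter> half_space i) (\<phi> ` (W \<inter> half_space i)) \<phi> \<psi>"
    and \<phi>': "smooth_on \<phi>' N" "open N" "\<phi>' ` N \<subseteq> \<phi> ` (W \<inter> half_space i)" and x: "x \<in> N"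
  shows "\<exists>T. linear T \<and> ((\<psi> \<circ> \<phi>') has_derivative T) (at x) \<and>
    frechet_derivative \<phi>' (at x) = frechet_derivative \<phi> (at (\<psi> (\<phi>' x))) \<circ> T"
proof -
  let ?D = "W \<inter> half_space i" and ?\<tau> = "\<psi> \<circ> \<phi>'"
  have \<tau>D: "?\<tau> y \<in> ?D" if "y \<in> N" for y
    using \<psi> \<phi>'(3) that unfolding homeomorphism_def by force
  have \<phi>\<tau>: "\<phi> (?\<tau> y) = \<phi>' y" if "y \<in> N" for y
    using homeomorphism_apply2[OF \<psi>] \<phi>'(3) that by fastforce
  have "continuous_on N ?\<tau>"
    using continuous_on_compose smooth_on_continuous[OF \<phi>'(1)] homeomorphism_cont2[OF \<psi>]
      continuous_on_subset \<phi>'(3) by metis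
  then have cont: "isCont ?\<tau> x" using \<phi>'(2) x continuous_on_eq_continuous_at by blast
  let ?d = "frechet_derivative \<phi> (at (?\<tau> x))" and ?d' = "frechet_derivative \<phi>' (at x)"
  have d: "(\<phi> has_derivative ?d) (at (?\<tau> x))"
    using smooth_on_has_derivative[OF local_parametrizationD(2)[OF \<phi>]] \<tau>D[OF x] by blast
  have d': "(\<phi>' has_derivative ?d') (at x)" by (rule smooth_on_has_derivative[OF \<phi>'(1) x])
  obtain P where P: "linear P" "P \<circ> ?d = id"
    using linear_injective_left_inverse[OF has_derivative_linear[OF d]] local_parametrizationD(3)[OF \<phi> \<tau>D[OF x]] by blast
  have near: "eventually (\<lambda>y. y \<in> N) (at x)" using \<phi>'(2) x by (rule eventually_at_in_open')
  have \<tau>: "(?\<tau> has_derivative P \<circ> ?d') (at x)"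
  proof (rule differentiable_through_immersion[OF d _ _ cont d'])
    show "bounded_linear P" using P(1) by (simp add: linear_conv_bounded_linear)
    show "P (?d v) = v" for v using P(2) by (metis comp_apply id_apply)
    show "eventually (\<lambda>y. \<phi> (?\<tau> y) = \<phi>' y) (at x)" using near by eventually_elim (rule \<phi>\<tau>)
    show "\<phi> (?\<tau> x) = \<phi>' x" using x by (rule \<phi>\<tau>)
  qed
  have "((\<phi> \<circ> ?\<tau>) has_derivative ?d \<circ> (P \<circ> ?d')) (at x)" by (rule diff_chain_at[OF \<tau> d])
  then have "(\<phi>' has_derivative ?d \<circ> (P \<circ> ?d')) (at x)"
    by (rule has_derivative_transform_within_open[OF _ \<phi>'(2) x]) (metis \<phi>\<tau> comp_apply)
  then have "?d' = ?d \<circ> (P \<circ> ?d')" using has_derivative_unique d' by blast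
  then show ?thesis using \<tau> has_derivative_linear by fastforce
qed

text \<open>Only parameters \<open>x\<close> of \<open>\<phi>'\<close> with \<open>x $ i' > 0\<close> are transformed to the chart \<open>\<phi>\<close>; those with
  \<open>x $ i' = 0\<close> form a null set. This gives a one-sided estimate without any knowledge of where the
  transition map sends boundary points, and that is all that the supremum of the chart volumes requires.\<close>

lemma chart_volume_le_chart_volume:
  fixes i i' :: "'k::{finite,wellorder}" and M :: "(real^'d) set"
  assumes \<phi>: "local_parametrization M i W \<phi>" and \<phi>': "local_parametrization M i' W' \<phi>'"
    and Y: "Y \<in> sets (restrict_space borel M)" "Y \<subseteq> \<phi> ` (W \<inter> half_space i)"
  shows "emeasure (chart_volume M i' W' \<phi>') Y \<le> emeasure (chart_volume M i W \<phi>) Y"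
proof -
  let ?D = "W \<inter> half_space i"
  obtain \<psi> where \<psi>: "homeomorphism ?D (\<phi> ` ?D) \<phi> \<psi>" using local_parametrizationD(5)[OF \<phi>] by blast
  obtain \<psi>' where \<psi>': "homeomorphism (W' \<inter> half_space i') (\<phi>' ` (W' \<inter> half_space i')) \<phi>' \<psi>'"
    using local_parametrizationD(5)[OF \<phi>'] by blast
  obtain O' where O': "open O'" "\<phi> ` ?D = M \<inter> O'"
    using local_parametrizationD(4)[OF \<phi>] by (auto simp: openin_open)
  define N0 where "N0 = W' \<inter> {x. 0 < x $ i'}"
  have N0: "open N0" "N0 \<subseteq> W' \<inter> half_space i'"
    using local_parametrizationD(1)[OF \<phi>'] unfolding N0_def half_space_def
    by (auto intro!: open_Int open_Collect_less continuous_intros)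
  define N where "N = N0 \<inter> \<phi>' -` O'"
  have smooth: "smooth_on \<phi>' W'" by (rule local_parametrizationD(2)[OF \<phi>'])
  have smoothN: "smooth_on \<phi>' N"
    using N0(2) by (intro smooth_on_subset[OF smooth]) (auto simp: N_def)
  have N: "open N"
    unfolding N_def using N0 smooth_on_continuous[OF smooth] O'(1)
    by (intro continuous_open_preimage) (auto intro: continuous_on_subset)
  have N_img: "\<phi>' ` N \<subseteq> \<phi> ` ?D"
    using N0(2) local_parametrizationD(6)[OF \<phi>'] by (auto simp: N_def O'(2))
  obtain T where T: "\<And>x. x \<in> N \<Longrightarrow> linear (T x)" "\<And>x. x \<in> N \<Longrightarrow> ((\<psi> \<circ> \<phi>') has_derivative T x) (at x)"
      "\<And>x. x \<in> N \<Longrightarrow> frechet_derivative \<phi>' (at x) = frechet_derivative \<phi> (at (\<psi> (\<phi>' x))) \<circ> T x"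
    using transition_map_derivative[OF \<phi> \<psi> smoothN N N_img] by metis
  define S where "S = N \<inter> \<phi>' -` Y"
  have NS: "N \<inter> \<phi>' -` Y = N \<inter> (W' \<inter> half_space i' \<inter> \<phi>' -` Y)" using N0(2) by (auto simp: N_def)
  have S_borel: "S \<in> sets borel"
    unfolding S_def NS by (rule sets.Int[OF borel_open[OF N] chart_preimage_borel[OF \<phi>' Y(1)]])
  define f where "f x = volume_density \<phi> x * indicator ?D x" for x
  have f_meas: "f \<in> borel_measurable borel" unfolding f_def by (rule chart_volume_measurable(2)[OF \<phi>])
  have f_nonneg: "0 \<le> f y" for y
    unfolding f_def using volume_density_pos[OF local_parametrizationD(2)[OF \<phi>], of y] local_parametrizationD(3)[OF \<phi>, of y]
    by (auto split: split_indicator)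
  have \<psi>_in: "\<psi> (\<phi>' x) \<in> ?D \<and> \<phi> (\<psi> (\<phi>' x)) = \<phi>' x" if "x \<in> N" for x
  proof -
    have "\<phi>' x \<in> \<phi> ` ?D" using N_img that by blast
    then show ?thesis using homeomorphism_apply2[OF \<psi>] homeomorphism_image2[OF \<psi>] by (metis imageI)
  qed
  have null: "AE x in lborel. x $ i' \<noteq> (0::real)"
  proof -
    have "negligible {x :: real^'k::_. x $ i' = 0}" by (rule negligible_standard_hyperplane_cart)
    moreover have "{x :: real^'k::_. x $ i' = 0} \<in> sets borel"
      by (intro borel_closed closed_Collect_eq continuous_intros)
    ultimately have "{x :: real^'k::_. x $ i' = 0} \<in> null_sets lborel"
      using null_sets_completion_iff[of "{x :: real^'k::_. x $ i' = 0}" lborel]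
      by (simp add: negligible_iff_null_sets)
    then show ?thesis by (rule AE_I') auto
  qed
  have "emeasure (chart_volume M i' W' \<phi>') Y
      = (\<integral>\<^sup>+x. ennreal (volume_density \<phi>' x) * indicator (W' \<inter> half_space i' \<inter> \<phi>' -` Y) x \<partial>lborel)"
    by (rule emeasure_chart_volume[OF \<phi>' Y(1)])
  also have "\<dots> = (\<integral>\<^sup>+x. ennreal (volume_density \<phi>' x) * indicator S x \<partial>lborel)"
  proof (intro nn_integral_cong_AE, use null in eventually_elim)
    fix x :: "real^'k::_" assume "x $ i' \<noteq> 0"
    then have "x \<in> W' \<inter> half_space i' \<inter> \<phi>' -` Y \<longleftrightarrow> x \<in> S"
      using Y(2) O'(2) by (auto simp: S_def N_def N0_def half_space_def)
    then show "ennreal (volume_density \<phi>' x) * indicator (W' \<inter> half_space i' \<inter> \<phi>' -` Y) x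
        = ennreal (volume_density \<phi>' x) * indicator S x"
      by (simp split: split_indicator)
  qed
  also have "\<dots> = (\<integral>\<^sup>+x. ennreal (\<bar>det (matrix (T x))\<bar> * f ((\<psi> \<circ> \<phi>') x)) * indicator S x \<partial>lborel)"
  proof (intro nn_integral_cong)
    fix x :: "real^'k::_"
    show "ennreal (volume_density \<phi>' x) * indicator S x
        = ennreal (\<bar>det (matrix (T x))\<bar> * f ((\<psi> \<circ> \<phi>') x)) * indicator S x"
    proof (cases "x \<in> S")
      case True
      then have x: "x \<in> N" by (simp add: S_def)
      have "volume_density \<phi>' x = \<bar>det (matrix (T x))\<bar> * volume_density \<phi> (\<psi> (\<phi>' x))"
        using \<psi>_in[OF x] by (intro volume_density_transform T(1,3) x smooth_on_linear_derivative[OF local_parametrizationD(2)[OF \<phi>]]) auto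
      then show ?thesis using \<psi>_in[OF x] by (simp add: f_def)
    qed simp
  qed
  also have "\<dots> \<le> (\<integral>\<^sup>+y. ennreal (f y) * indicator (?D \<inter> \<phi> -` Y) y \<partial>lborel)"
  proof (rule nn_integral_change_of_variables_le[OF f_meas f_nonneg])
    show "S \<in> sets lebesgue" using S_borel by simp
    show "?D \<inter> \<phi> -` Y \<in> sets borel" by (rule chart_preimage_borel[OF \<phi> Y(1)])
    show "(\<psi> \<circ> \<phi>') ` S \<subseteq> ?D \<inter> \<phi> -` Y" using \<psi>_in by (auto simp: S_def)
    show "((\<psi> \<circ> \<phi>') has_derivative T x) (at x within S)" if "x \<in> S" for x
      using T(2) that by (auto simp: S_def intro: has_derivative_at_withinI)
    show "inj_on (\<psi> \<circ> \<phi>') S"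
    proof (rule inj_onI)
      fix x y assume "x \<in> S" "y \<in> S" "(\<psi> \<circ> \<phi>') x = (\<psi> \<circ> \<phi>') y"
      then have "x \<in> N" "y \<in> N" "\<phi>' x = \<phi>' y" using \<psi>_in by (auto simp: S_def) metis
      moreover from this have "x \<in> W' \<inter> half_space i'" "y \<in> W' \<inter> half_space i'"
        using N0(2) by (auto simp: N_def)
      ultimately show "x = y" using homeomorphism_apply1[OF \<psi>'] by metis
    qed
  qed
  also have "\<dots> = emeasure (chart_volume M i W \<phi>) Y"
    unfolding emeasure_chart_volume[OF \<phi> Y(1)] f_def
    by (intro nn_integral_cong) (auto split: split_indicator)
  finally show ?thesis .
qed

section \<open>The volume measure in a chart\<close>

text \<open>The empty chart keeps the family of chart volumes nonempty even for \<open>M = {}\<close>, so that the supremum has the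
  expected measurable sets.\<close>

lemma local_parametrization_empty: "local_parametrization M (i::'k::finite) {} (\<lambda>_. 0)"
proof -
  have "C_on n f {}" for n and f :: "real^'k \<Rightarrow> real^'d"
    by (induction n arbitrary: f) auto
  then show ?thesis
    unfolding local_parametrization_def smooth_on_def
    by (auto intro!: exI[of _ "\<lambda>_. 0"] simp: homeomorphism_def)
qed

lemma sets_volume_measure:
  "sets (volume_measure TYPE('k::finite) M) = sets (restrict_space borel M)"
proof -
  let ?C = "{chart_volume M i W \<phi> | (i::'k) W \<phi>. local_parametrization M i W \<phi>}"
  have "?C \<noteq> {}" using local_parametrization_empty by blast
  moreover have "sets m = sets (restrict_space borel M)" if "m \<in> ?C" for m
    using that by (auto simp: sets_chart_volume)
  ultimately show ?thesis
    unfolding volume_measure_def using sets_SUP[of ?C "\<lambda>m. m" "restrict_space borel M"] by simp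
qed

lemma space_volume_measure: "space (volume_measure TYPE('k::finite) M) = M"
  using sets_eq_imp_space_eq[OF sets_volume_measure] by (simp add: space_restrict_space)

text \<open>For the nontrivial inequality, the supremum is compared with the measure \<open>\<nu>\<close> that agrees with the given
  chart volume on subsets of the chart image and is infinite on all other sets. It dominates
  every chart volume.\<close>

lemma emeasure_volume_measure_chart:
  fixes i :: "'k::{finite,wellorder}"
  assumes \<phi>: "local_parametrization M i W \<phi>"
    and Y: "Y \<in> sets (restrict_space borel M)" "Y \<subseteq> \<phi> ` (W \<inter> half_space i)"
  shows "emeasure (volume_measure TYPE('k) M) Y = emeasure (chart_volume M i W \<phi>) Y"
proof (rule antisym)
  let ?C = "{chart_volume M i W \<phi> | (i::'k) W \<phi>. local_parametrization M i W \<phi>}"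
  let ?c = "chart_volume M i W \<phi>" and ?U = "\<phi> ` (W \<inter> half_space i)"
  let ?B = "restrict_space borel M"
  have sets_eq: "sets (Sup ?C) = sets ?B"
    using sets_volume_measure[where 'k='k] unfolding volume_measure_def .
  have "?c \<le> Sup ?C" using \<phi> by (intro Sup_upper) blast
  then show "emeasure ?c Y \<le> emeasure (volume_measure TYPE('k) M) Y"
    unfolding volume_measure_def by (rule le_measureD3) (simp add: sets_eq)
  define v where "v X = (if X \<subseteq> ?U then emeasure ?c X else \<infinity>)" for X
  define \<nu> where "\<nu> = measure_of M (sets ?B) v"
  have sp: "sets ?B \<subseteq> Pow M" using sets.sets_into_space[of _ ?B] by (auto simp: space_restrict_space)
  have sa: "sigma_algebra M (sets ?B)" using sets.sigma_algebra_axioms[of ?B] by (simp add: space_restrict_space)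
  have sets_\<nu>: "sets \<nu> = sets ?B"
    unfolding \<nu>_def using sa sp by (simp add: sigma_algebra.sigma_sets_eq)
  have \<nu>: "emeasure \<nu> X = v X" if "X \<in> sets ?B" for X
  proof (rule emeasure_measure_of[OF \<nu>_def sp])
    show "positive (sets \<nu>) v" by (simp add: positive_def v_def)
    show "countably_additive (sets \<nu>) v"
    proof (rule countably_additiveI)
      fix A :: "nat \<Rightarrow> _" assume A: "range A \<subseteq> sets \<nu>" "disjoint_family A"
      show "(\<Sum>j. v (A j)) = v (\<Union> (range A))"
      proof (cases "\<forall>j. A j \<subseteq> ?U")
        case True
        then have "\<Union> (range A) \<subseteq> ?U" by blast
        then show ?thesis
          using True A suminf_emeasure[of A ?c] by (simp add: v_def sets_\<nu>)
      next
        case False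
        then obtain j where "\<not> A j \<subseteq> ?U" by blast
        then have j: "v (A j) = \<infinity>" by (simp add: v_def)
        have "v (A j) \<le> (\<Sum>j. v (A j))"
          using sum_le_suminf[of "\<lambda>j. v (A j)" "{j}"] by simp
        then have "(\<Sum>j. v (A j)) = \<infinity>" using j by (simp add: top_unique)
        moreover have "\<not> \<Union> (range A) \<subseteq> ?U" using False by blast
        ultimately show ?thesis by (simp add: v_def)
      qed
    qed
    show "X \<in> sets \<nu>" using that by (simp add: sets_\<nu>)
  qed
  have "Sup ?C \<le> \<nu>"
  proof (rule Sup_least)
    fix m assume "m \<in> ?C"
    then obtain i' :: 'k and W' \<phi>' where m: "m = chart_volume M i' W' \<phi>'" and \<phi>': "local_parametrization M i' W' \<phi>'"
      by blast
    have "emeasure m X \<le> emeasure \<nu> X" for X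
    proof (cases "X \<in> sets ?B")
      case True
      then show ?thesis
        using chart_volume_le_chart_volume[OF \<phi> \<phi>' True] by (simp add: \<nu> v_def m)
    qed (simp add: m emeasure_notin_sets)
    then show "m \<le> \<nu>"
      unfolding le_measure_iff using sets_eq_imp_space_eq[of m \<nu>] by (simp add: m sets_\<nu> le_fun_def)
  qed
  then have "emeasure (Sup ?C) Y \<le> emeasure \<nu> Y"
    by (rule le_measureD3) (simp add: sets_eq sets_\<nu>)
  then show "emeasure (volume_measure TYPE('k) M) Y \<le> emeasure ?c Y"
    using Y by (simp add: volume_measure_def \<nu> v_def)
qed

lemma nn_integral_volume_measure_chart:
  fixes i :: "'k::{finite,wellorder}" and F :: "real^'d \<Rightarrow> ennreal"
  assumes \<phi>: "local_parametrization M i W \<phi>" and F: "F \<in> borel_measurable (restrict_space borel M)"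
  shows "(\<integral>\<^sup>+y. F y * indicator (\<phi> ` (W \<inter> half_space i)) y \<partial>volume_measure TYPE('k) M)
    = (\<integral>\<^sup>+x. ennreal (volume_density \<phi> x) * F (\<phi> x) * indicator (W \<inter> half_space i) x \<partial>lborel)"
proof -
  let ?\<mu> = "volume_measure TYPE('k) M" and ?U = "\<phi> ` (W \<inter> half_space i)" and ?c = "chart_volume M i W \<phi>"
  have U: "?U \<in> sets ?\<mu>"
    using openin_imp_restrict_borel[OF local_parametrizationD(4)[OF \<phi>]] by (simp add: sets_volume_measure)
  have F': "F \<in> borel_measurable ?\<mu>"
    using F by (simp add: measurable_cong_sets[OF sets_volume_measure refl])
  have "density ?\<mu> (indicator ?U) = ?c"
  proof (rule measure_eqI)
    show "sets (density ?\<mu> (indicator ?U)) = sets ?c" by (simp add: sets_volume_measure)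
    fix Y assume "Y \<in> sets (density ?\<mu> (indicator ?U))"
    then have Y: "Y \<in> sets ?\<mu>" by simp
    then have YB: "Y \<in> sets (restrict_space borel M)" by (simp add: sets_volume_measure)
    have "emeasure (density ?\<mu> (indicator ?U)) Y = emeasure ?\<mu> (?U \<inter> Y)"
      using U Y by (simp add: emeasure_density indicator_inter_arith[symmetric])
    also have "\<dots> = emeasure ?c (?U \<inter> Y)"
      using U Y by (intro emeasure_volume_measure_chart[OF \<phi>]) (auto simp: sets_volume_measure)
    also have "\<dots> = emeasure ?c Y"
    proof -
      have "?U \<inter> Y \<in> sets (restrict_space borel M)" using U Y by (auto simp: sets_volume_measure)
      then show ?thesis
        unfolding emeasure_chart_volume[OF \<phi> YB]
        by (subst emeasure_chart_volume[OF \<phi>]) (auto intro!: nn_integral_cong split: split_indicator)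
    qed
    finally show "emeasure (density ?\<mu> (indicator ?U)) Y = emeasure ?c Y" .
  qed
  then have "(\<integral>\<^sup>+y. F y \<partial>?c) = (\<integral>\<^sup>+y. indicator ?U y * F y \<partial>?\<mu>)"
    using U F' by (metis nn_integral_density borel_measurable_indicator)
  then show ?thesis
    unfolding nn_integral_chart_volume[OF \<phi> F] by (simp add: mult.commute)
qed

section \<open>Local control in half-ball charts\<close>

text \<open>The inequality on a convex set of parameters is carried over by a Lipschitz map \<open>\<phi>\<close> under which \<open>\<mu>\<close> on \<open>U\<close> and
  Lebesgue measure on \<open>D\<close> are comparable. The constants \<open>a\<close> and \<open>b\<close> enter squared, since
  energies are double integrals; the Lipschitz constant \<open>L\<close> ensures that steps of length \<open>d / n\<close> in \<open>D\<close> become pairs at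
  distance at most \<open>r\<close>.\<close>

lemma near_controlled_convex_chart:
  fixes \<mu> :: "'b::{metric_space,second_countable_topology} measure" and D :: "'a::euclidean_space set"
    and \<phi> :: "'a \<Rightarrow> 'b" and a b L d :: real
  assumes id_meas: "(\<lambda>y. y) \<in> measurable \<mu> borel" and U[measurable]: "U \<in> sets \<mu>"
    and \<phi>[measurable]: "\<phi> \<in> measurable borel \<mu>" and D[measurable]: "D \<in> sets borel" and "convex D"
    and a: "a > 0" and b: "b > 0" and L: "L \<ge> 0" and d: "d \<ge> 0"
    and lower: "\<And>F. F \<in> borel_measurable \<mu> \<Longrightarrow>
      ennreal a * (\<integral>\<^sup>+x. F (\<phi> x) * indicator D x \<partial>lborel) \<le> (\<integral>\<^sup>+y. F y * indicator U y \<partial>\<mu>)"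
    and upper: "\<And>F. F \<in> borel_measurable \<mu> \<Longrightarrow>
      (\<integral>\<^sup>+y. F y * indicator U y \<partial>\<mu>) \<le> ennreal b * (\<integral>\<^sup>+x. F (\<phi> x) * indicator D x \<partial>lborel)"
    and lip: "\<And>x y. x \<in> D \<Longrightarrow> y \<in> D \<Longrightarrow> dist (\<phi> x) (\<phi> y) \<le> L * norm (x - y)"
    and diam: "\<And>x y. x \<in> D \<Longrightarrow> y \<in> D \<Longrightarrow> norm (x - y) \<le> d"
  shows "near_controlled \<mu> (DIM('a) + 2) U U"
proof -
  let ?m = "DIM('a) + 2"
  show ?thesis unfolding near_controlled_def
  proof (intro exI[of _ "b\<^sup>2 * (L * d + 2) ^ ?m / a\<^sup>2"] conjI ballI allI impI)
    show "0 \<le> b\<^sup>2 * (L * d + 2) ^ ?m / a\<^sup>2" using L d by simp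
    fix u :: "'b \<Rightarrow> real" and r :: real
    assume u[measurable]: "u \<in> borel_measurable \<mu>" and r: "0 < r \<and> r \<le> 1"
    \<comment> \<open>Large enough for \<open>L d / n \<le> r\<close>; the bound \<open>n \<le> (L d + 2) / r\<close> uses \<open>r \<le> 1\<close>.\<close>
    define n where "n = nat \<lceil>L * d / r\<rceil> + 1"
    have n0: "n > 0" by (simp add: n_def)
    have "L * d / r \<ge> 0" using L d r by simp
    then have n_bounds: "L * d / r \<le> n" "n \<le> L * d / r + 2" unfolding n_def by linarith+
    have n_r: "L * (d / n) \<le> r"
      using n_bounds(1) n0 r by (simp add: field_simps)
    have "real n \<le> (L * d + 2) / r"
      using n_bounds(2) r by (auto simp: field_simps intro: order_trans)
    then have n_pow: "real n ^ ?m \<le> (L * d + 2) ^ ?m / r ^ ?m"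
      unfolding power_divide[symmetric] by (rule power_mono) simp
    define q where "q x y = ennreal ((u x - u y)\<^sup>2)" for x y
    define g where "g x y = q x y * indicator {..r} (dist x y)" for x y
    have q_meas[measurable]: "case_prod q \<in> borel_measurable (\<mu> \<Otimes>\<^sub>M \<mu>)"
      unfolding q_def by measurable
    have [measurable]: "(\<lambda>(x, y). dist x y) \<in> borel_measurable (\<mu> \<Otimes>\<^sub>M \<mu>)"
    proof -
      note id_meas[measurable]
      show ?thesis by measurable
    qed
    have g_meas[measurable]: "case_prod g \<in> borel_measurable (\<mu> \<Otimes>\<^sub>M \<mu>)"
      unfolding g_def by measurable
    have v_meas: "(\<lambda>x. u (\<phi> x)) \<in> borel_measurable borel" by measurable
    define I where "I h = (\<integral>\<^sup>+x. \<integral>\<^sup>+y. h (\<phi> x) (\<phi> y) * indicator D x * indicator D y \<partial>lborel \<partial>lborel)"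
      for h :: "'b \<Rightarrow> 'b \<Rightarrow> ennreal"
    have I_eq: "I h = (\<integral>\<^sup>+x. (\<integral>\<^sup>+y. h (\<phi> x) (\<phi> y) * indicator D y \<partial>lborel) * indicator D x \<partial>lborel)"
      if [measurable]: "case_prod h \<in> borel_measurable (\<mu> \<Otimes>\<^sub>M \<mu>)" for h
      unfolding I_def by (intro nn_integral_cong) (simp split: split_indicator)
    have up: "pair_energy \<mu> u U U \<le> ennreal (b\<^sup>2) * I q"
    proof -
      have "pair_energy \<mu> u U U = (\<integral>\<^sup>+x. (\<integral>\<^sup>+y. q x y * indicator U y \<partial>\<mu>) * indicator U x \<partial>\<mu>)"
        unfolding pair_energy_def q_def by (intro nn_integral_cong) (simp split: split_indicator)
      also have "\<dots> \<le> (\<integral>\<^sup>+x. (ennreal b * (\<integral>\<^sup>+y. q x (\<phi> y) * indicator D y \<partial>lborel)) * indicator U x \<partial>\<mu>)"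
        by (intro nn_integral_mono mult_right_mono upper) auto
      also have "\<dots> \<le> ennreal b * (\<integral>\<^sup>+x. (ennreal b * (\<integral>\<^sup>+y. q (\<phi> x) (\<phi> y) * indicator D y \<partial>lborel)) * indicator D x \<partial>lborel)"
        by (rule upper) measurable
      also have "\<dots> = ennreal (b\<^sup>2) * I q"
        using b by (simp add: I_eq nn_integral_cmult mult.assoc power2_eq_square ennreal_mult)
      finally show ?thesis .
    qed
    have low: "ennreal (a\<^sup>2) * I g \<le> near_energy \<mu> u r"
    proof -
      have "ennreal (a\<^sup>2) * I g = ennreal a * (\<integral>\<^sup>+x. (ennreal a * (\<integral>\<^sup>+y. g (\<phi> x) (\<phi> y) * indicator D y \<partial>lborel)) * indicator D x \<partial>lborel)"
        using a by (simp add: I_eq nn_integral_cmult mult.assoc power2_eq_square ennreal_mult)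
      also have "\<dots> \<le> (\<integral>\<^sup>+x. (ennreal a * (\<integral>\<^sup>+y. g x (\<phi> y) * indicator D y \<partial>lborel)) * indicator U x \<partial>\<mu>)"
        by (rule lower) measurable
      also have "\<dots> \<le> (\<integral>\<^sup>+x. (\<integral>\<^sup>+y. g x y * indicator U y \<partial>\<mu>) * indicator U x \<partial>\<mu>)"
        by (intro nn_integral_mono mult_right_mono lower) auto
      also have "\<dots> \<le> (\<integral>\<^sup>+x. (\<integral>\<^sup>+y. g x y \<partial>\<mu>) \<partial>\<mu>)"
      proof (intro nn_integral_mono)
        fix x
        have "(\<integral>\<^sup>+y. g x y * indicator U y \<partial>\<mu>) \<le> (\<integral>\<^sup>+y. g x y \<partial>\<mu>)"
          by (intro nn_integral_mono) (simp split: split_indicator)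
        then show "(\<integral>\<^sup>+y. g x y * indicator U y \<partial>\<mu>) * indicator U x \<le> (\<integral>\<^sup>+y. g x y \<partial>\<mu>)"
          by (simp split: split_indicator)
      qed
      finally show ?thesis unfolding near_energy_def g_def q_def .
    qed
    have "I q \<le> ennreal (real n ^ ?m) * (\<integral>\<^sup>+x. \<integral>\<^sup>+y. q (\<phi> x) (\<phi> y) * indicator D x * indicator D y
        * indicator {..d / n} (norm (x - y)) \<partial>lborel \<partial>lborel)"
      unfolding I_def q_def by (rule convex_nonlocal_poincare[OF v_meas D \<open>convex D\<close> n0 diam])
    also have "\<dots> \<le> ennreal (real n ^ ?m) * I g"
      unfolding I_def
    proof (intro mult_left_mono nn_integral_mono)
      fix x y
      show "q (\<phi> x) (\<phi> y) * indicator D x * indicator D y * indicator {..d / n} (norm (x - y))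
          \<le> g (\<phi> x) (\<phi> y) * indicator D x * indicator D y"
      proof (cases "x \<in> D \<and> y \<in> D \<and> norm (x - y) \<le> d / n")
        case True
        then have "dist (\<phi> x) (\<phi> y) \<le> L * norm (x - y)" by (intro lip) auto
        also have "\<dots> \<le> L * (d / n)" using True L by (intro mult_left_mono) auto
        also have "\<dots> \<le> r" by (rule n_r)
        finally show ?thesis using True by (simp add: g_def)
      qed auto
    qed simp
    finally have mid: "I q \<le> ennreal (real n ^ ?m) * I g" .
    have "pair_energy \<mu> u U U \<le> ennreal (b\<^sup>2) * (ennreal (real n ^ ?m) * I g)"
      using up mid by (meson mult_left_mono order_trans zero_le)
    also have "\<dots> = ennreal (b\<^sup>2 * real n ^ ?m / a\<^sup>2) * (ennreal (a\<^sup>2) * I g)"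
      using a by (simp add: mult.assoc[symmetric] ennreal_mult[symmetric])
    also have "\<dots> \<le> ennreal (b\<^sup>2 * (L * d + 2) ^ ?m / a\<^sup>2 / r ^ ?m) * near_energy \<mu> u r"
    proof (intro mult_mono ennreal_leI low)
      have "b\<^sup>2 * real n ^ ?m / a\<^sup>2 \<le> b\<^sup>2 * ((L * d + 2) ^ ?m / r ^ ?m) / a\<^sup>2"
        by (intro divide_right_mono mult_left_mono n_pow) auto
      then show "b\<^sup>2 * real n ^ ?m / a\<^sup>2 \<le> b\<^sup>2 * (L * d + 2) ^ ?m / a\<^sup>2 / r ^ ?m"
        by (simp add: field_simps)
    qed auto
    finally show "pair_energy \<mu> u U U \<le> ennreal (b\<^sup>2 * (L * d + 2) ^ ?m / a\<^sup>2 / r ^ ?m) * near_energy \<mu> u r" .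
  qed
qed

text \<open>Directional derivatives along the basis vectors are continuous, hence bounded on the compact ball; the sum of these
  bounds dominates the operator norm of the derivative, and the ball is convex.\<close>

lemma smooth_on_lipschitz_cball:
  fixes \<phi> :: "'a::euclidean_space \<Rightarrow> 'b::real_normed_vector"
  assumes \<phi>: "smooth_on \<phi> W" and W: "cball x0 \<rho> \<subseteq> W"
  shows "\<exists>L\<ge>0. \<forall>x\<in>cball x0 \<rho>. \<forall>y\<in>cball x0 \<rho>. dist (\<phi> x) (\<phi> y) \<le> L * norm (x - y)"
proof -
  let ?K = "cball x0 \<rho>" and ?d = "\<lambda>x. frechet_derivative \<phi> (at x)"
  have "\<exists>B\<ge>0. \<forall>x\<in>?K. norm (?d x b) \<le> B" for b
  proof -
    have "bounded ((\<lambda>x. ?d x b) ` ?K)"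
      by (intro compact_imp_bounded compact_continuous_image
          continuous_on_subset[OF smooth_on_continuous_derivative[OF \<phi>] W] compact_cball)
    then obtain B where "\<forall>x\<in>?K. norm (?d x b) \<le> B" by (auto simp: bounded_iff)
    then show ?thesis by (intro exI[of _ "max 0 B"]) auto
  qed
  then obtain B where B: "\<And>b. B b \<ge> 0" "\<And>b x. x \<in> ?K \<Longrightarrow> norm (?d x b) \<le> B b" by metis
  have on: "onorm (?d x) \<le> (\<Sum>b\<in>Basis. B b)" if x: "x \<in> ?K" for x
  proof (rule onorm_le)
    fix v
    interpret linear "?d x" using smooth_on_linear_derivative[OF \<phi>] x W by blast
    have "?d x v = ?d x (\<Sum>b\<in>Basis. (v \<bullet> b) *\<^sub>R b)"
      by (simp add: euclidean_representation)
    also have "\<dots> = (\<Sum>b\<in>Basis. (v \<bullet> b) *\<^sub>R ?d x b)"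
      by (simp only: sum scaleR)
    also have "norm \<dots> \<le> (\<Sum>b\<in>Basis. norm v * B b)"
      using Basis_le_norm B x by (intro sum_norm_le) (auto intro!: mult_mono)
    finally show "norm (?d x v) \<le> (\<Sum>b\<in>Basis. B b) * norm v"
      by (simp add: sum_distrib_left mult.commute)
  qed
  have "dist (\<phi> x) (\<phi> y) \<le> (\<Sum>b\<in>Basis. B b) * norm (x - y)" if "x \<in> ?K" "y \<in> ?K" for x y
    unfolding dist_norm
  proof (rule differentiable_bound[of ?K \<phi> ?d])
    show "(\<phi> has_derivative ?d z) (at z within ?K)" if "z \<in> ?K" for z
      using smooth_on_has_derivative[OF \<phi>] W that by (blast intro: has_derivative_at_withinI)
  qed (use that on in auto)
  then show ?thesis using B(1) by (intro exI[of _ "\<Sum>b\<in>Basis. B b"]) (auto intro: sum_nonneg)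
qed

text \<open>Pushing the centre by \<open>\<rho> / 2\<close> into the half-space makes room for a full ball of radius \<open>\<rho> / 2\<close>.\<close>

lemma half_ball_emeasure_pos:
  fixes i :: "'k::finite"
  assumes "x0 \<in> half_space i" "\<rho> > 0"
  shows "emeasure lborel (ball x0 \<rho> \<inter> half_space i) > 0"
proof -
  define c where "c = x0 + (\<rho> / 2) *\<^sub>R axis i 1"
  have sub: "ball c (\<rho> / 2) \<subseteq> ball x0 \<rho> \<inter> half_space i"
  proof
    fix x assume "x \<in> ball c (\<rho> / 2)"
    then have x: "norm (x - c) < \<rho> / 2" by (simp add: dist_norm norm_minus_commute)
    have "norm (x - x0) \<le> norm (x - c) + norm ((\<rho> / 2) *\<^sub>R axis i 1 :: real^'k)"
      using norm_triangle_ineq[of "x - c" "c - x0"] by (simp add: c_def)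
    moreover have "norm ((\<rho> / 2) *\<^sub>R axis i 1 :: real^'k) = \<rho> / 2"
      using assms(2) by simp
    ultimately have "norm (x - x0) < \<rho>" using x by simp
    moreover have "\<bar>(x - c) $ i\<bar> < \<rho> / 2" using component_le_norm_cart[of "x - c" i] x by linarith
    then have "- (\<rho> / 2) < (x - c) $ i" by linarith
    then have "0 \<le> x $ i" using assms(1) by (simp add: c_def half_space_def)
    ultimately show "x \<in> ball x0 \<rho> \<inter> half_space i"
      by (simp add: dist_norm norm_minus_commute half_space_def)
  qed
  have "0 < measure lborel (ball c (\<rho> / 2))" using content_ball_pos[of "\<rho> / 2" c] assms(2) by simp
  then have "0 < emeasure lborel (ball c (\<rho> / 2))"
    by (metis emeasure_eq_ennreal_measure ennreal_less_zero_iff measure_zero_top less_irrefl)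
  also have "\<dots> \<le> emeasure lborel (ball x0 \<rho> \<inter> half_space i)"
    by (rule emeasure_mono[OF sub]) simp
  finally show ?thesis .
qed

text \<open>The neighbourhood \<open>U\<close> is the image of a half-ball \<open>D\<close> in a chart. \<open>D\<close> is convex, whether or not it touches the
  boundary, and its closure is a compact set in the chart domain, where the volume density has positive
  lower and finite upper bounds and the parametrization is Lipschitz.\<close>

lemma locally_near_controlled:
  fixes M :: "(real^'d) set"
  assumes M: "smooth_submanifold TYPE('k::{finite,wellorder}) M"
    and V: "openin (top_of_set M) V" and y0: "y0 \<in> V"
  shows "\<exists>U. openin (top_of_set M) U \<and> y0 \<in> U \<and> U \<subseteq> V \<and>
    0 < emeasure (volume_measure TYPE('k) M) U \<and> emeasure (volume_measure TYPE('k) M) U < \<infinity> \<and>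
    near_controlled (volume_measure TYPE('k) M) (CARD('k) + 2) U U"
proof -
  let ?\<mu> = "volume_measure TYPE('k) M"
  have y0M: "y0 \<in> M" using V y0 openin_imp_subset by blast
  then obtain i :: 'k and W \<phi> where \<phi>: "local_parametrization M i W \<phi>" and y0_in: "y0 \<in> \<phi> ` (W \<inter> half_space i)"
    using M unfolding smooth_submanifold_def by blast
  note par = local_parametrizationD[OF \<phi>]
  let ?W = "W \<inter> half_space i"
  obtain x0 where x0: "x0 \<in> ?W" "\<phi> x0 = y0" using y0_in by blast
  obtain V' where V': "open V'" "V = M \<inter> V'" using V by (auto simp: openin_open)
  have "open (W \<inter> \<phi> -` V')"
    using smooth_on_continuous[OF par(2)] par(1) V'(1) by (rule continuous_open_preimage)
  then obtain \<rho> where \<rho>: "\<rho> > 0" "cball x0 \<rho> \<subseteq> W \<inter> \<phi> -` V'"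
    using x0 y0 V'(2) open_contains_cball by (metis IntD1 IntD2 IntI vimageI)
  define D where "D = ball x0 \<rho> \<inter> half_space i"
  define U where "U = \<phi> ` D"
  have half_convex: "convex (half_space i)"
    unfolding half_space_def convex_def by auto
  have D: "D \<subseteq> ?W" "D \<in> sets borel" "convex D" "x0 \<in> D" "D \<subseteq> cball x0 \<rho>"
    using \<rho> x0 half_convex by (auto simp: D_def intro!: convex_Int)
  have DW: "openin (top_of_set ?W) D"
    unfolding openin_open using \<rho> D(1) by (intro exI[of _ "ball x0 \<rho>"]) (auto simp: D_def)
  obtain \<psi> where \<psi>: "homeomorphism ?W (\<phi> ` ?W) \<phi> \<psi>" using par(5) by blast
  have U_open: "openin (top_of_set M) U"
    unfolding U_def by (rule openin_trans[OF homeomorphism_imp_open_map[OF \<psi> DW] par(4)])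
  have U_V: "U \<subseteq> V" using \<rho>(2) D(5) U_open openin_imp_subset unfolding U_def V'(2) by blast
  have U_sets: "U \<in> sets ?\<mu>" using openin_imp_restrict_borel[OF U_open] by (simp add: sets_volume_measure)
  have U_iff: "\<phi> x \<in> U \<longleftrightarrow> x \<in> D" if "x \<in> ?W" for x
    unfolding U_def using that D(1) homeomorphism_apply1[OF \<psi>] by (metis image_iff subsetD)
  let ?K = "cball x0 \<rho> \<inter> half_space i"
  have "x0 \<in> ?K" using \<rho>(1) x0(1) by simp
  then have K: "?K \<noteq> {}" by blast
  have K_compact: "compact ?K" by (intro compact_Int_closed compact_cball closed_half_space)
  have K_sub: "?K \<subseteq> ?W" "D \<subseteq> ?K"
    using \<rho>(2) D(5) unfolding D_def by blast+
  have cont: "continuous_on ?K (volume_density \<phi>)"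
    using continuous_on_volume_density[OF par(2)] K_sub(1) continuous_on_subset by blast
  obtain xa where xa: "xa \<in> ?K" "\<And>x. x \<in> ?K \<Longrightarrow> volume_density \<phi> xa \<le> volume_density \<phi> x"
    using continuous_attains_inf[OF K_compact K cont] by blast
  obtain xb where xb: "xb \<in> ?K" "\<And>x. x \<in> ?K \<Longrightarrow> volume_density \<phi> x \<le> volume_density \<phi> xb"
    using continuous_attains_sup[OF K_compact K cont] by blast
  define a where "a = volume_density \<phi> xa"
  define b where "b = volume_density \<phi> xb"
  have a: "a > 0" unfolding a_def using xa(1) K_sub(1) by (intro volume_density_pos[OF par(2)] par(3)) auto
  have b: "b > 0" using a xa(2)[OF xb(1)] unfolding a_def b_def by simp
  obtain L where L: "L \<ge> 0" "\<And>x y. x \<in> cball x0 \<rho> \<Longrightarrow> y \<in> cball x0 \<rho> \<Longrightarrow> dist (\<phi> x) (\<phi> y) \<le> L * norm (x - y)"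
    using smooth_on_lipschitz_cball[OF par(2), of x0 \<rho>] \<rho>(2) by blast
  \<comment> \<open>A total Borel map is needed for Fubini; off the chart domain it takes the constant value \<open>y0\<close>.\<close>
  define \<phi>0 where "\<phi>0 x = (if x \<in> ?W then \<phi> x else y0)" for x
  have \<phi>0: "\<phi>0 \<in> measurable borel ?\<mu>"
  proof -
    have "{x \<in> space borel. x \<in> ?W} \<in> sets borel" using par(1) by simp
    then show ?thesis
      unfolding \<phi>0_def measurable_cong_sets[OF refl sets_volume_measure]
      using chart_volume_measurable(1)[OF \<phi>] y0M
      by (subst measurable_If_restrict_space_iff) (auto simp: space_restrict_space Int_def)
  qed
  have formula: "(\<integral>\<^sup>+y. F y * indicator U y \<partial>?\<mu>)
      = (\<integral>\<^sup>+x. ennreal (volume_density \<phi> x) * (F (\<phi>0 x) * indicator D x) \<partial>lborel)"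
    if F: "F \<in> borel_measurable ?\<mu>" for F
  proof -
    have FU: "(\<lambda>y. F y * indicator U y) \<in> borel_measurable (restrict_space borel M)"
    proof -
      have "(\<lambda>y. F y * indicator U y) \<in> borel_measurable ?\<mu>" using F U_sets by measurable
      then show ?thesis by (simp add: measurable_cong_sets[OF sets_volume_measure refl])
    qed
    have "U \<subseteq> \<phi> ` ?W" unfolding U_def using D(1) by blast
    then have "(\<integral>\<^sup>+y. F y * indicator U y \<partial>?\<mu>) = (\<integral>\<^sup>+y. F y * indicator U y * indicator (\<phi> ` ?W) y \<partial>?\<mu>)"
      by (intro nn_integral_cong) (auto split: split_indicator)
    also have "\<dots> = (\<integral>\<^sup>+x. ennreal (volume_density \<phi> x) * (F (\<phi> x) * indicator U (\<phi> x)) * indicator ?W x \<partial>lborel)"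
      by (rule nn_integral_volume_measure_chart[OF \<phi> FU])
    also have "\<dots> = (\<integral>\<^sup>+x. ennreal (volume_density \<phi> x) * (F (\<phi>0 x) * indicator D x) \<partial>lborel)"
    proof (intro nn_integral_cong)
      fix x
      show "ennreal (volume_density \<phi> x) * (F (\<phi> x) * indicator U (\<phi> x)) * indicator ?W x
          = ennreal (volume_density \<phi> x) * (F (\<phi>0 x) * indicator D x)"
        using U_iff[of x] D(1) by (cases "x \<in> ?W"; cases "x \<in> D") (auto simp: \<phi>0_def)
    qed
    finally show ?thesis .
  qed
  have meas_F\<phi>: "(\<lambda>x. F (\<phi>0 x) * indicator D x) \<in> borel_measurable lborel"
    if "F \<in> borel_measurable ?\<mu>" for F :: "_ \<Rightarrow> ennreal"
    using measurable_compose[OF \<phi>0 that] D(2) by measurable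
  have vd: "a \<le> volume_density \<phi> x" "volume_density \<phi> x \<le> b" if "x \<in> D" for x
    using xa(2) xb(2) K_sub(2) that unfolding a_def b_def by blast+
  have lower: "ennreal a * (\<integral>\<^sup>+x. F (\<phi>0 x) * indicator D x \<partial>lborel) \<le> (\<integral>\<^sup>+y. F y * indicator U y \<partial>?\<mu>)"
    if F: "F \<in> borel_measurable ?\<mu>" for F
    unfolding formula[OF F] nn_integral_cmult[OF meas_F\<phi>[OF F], symmetric]
    using vd(1) by (intro nn_integral_mono) (auto intro!: mult_right_mono ennreal_leI split: split_indicator)
  have upper: "(\<integral>\<^sup>+y. F y * indicator U y \<partial>?\<mu>) \<le> ennreal b * (\<integral>\<^sup>+x. F (\<phi>0 x) * indicator D x \<partial>lborel)"
    if F: "F \<in> borel_measurable ?\<mu>" for F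
    unfolding formula[OF F] nn_integral_cmult[OF meas_F\<phi>[OF F], symmetric]
    using vd(2) by (intro nn_integral_mono) (auto intro!: mult_right_mono ennreal_leI split: split_indicator)
  have "near_controlled ?\<mu> (DIM(real^'k::_) + 2) U U"
  proof (rule near_controlled_convex_chart[OF _ U_sets \<phi>0 D(2,3) a b L(1) _ lower upper])
    show "(\<lambda>y. y) \<in> measurable ?\<mu> borel"
      unfolding measurable_cong_sets[OF sets_volume_measure refl] by (rule measurable_restrict_space1) simp
    show "0 \<le> 2 * \<rho>" using \<rho> by simp
    show "dist (\<phi>0 x) (\<phi>0 y) \<le> L * norm (x - y)" if "x \<in> D" "y \<in> D" for x y
    proof -
      have "x \<in> ?W" "y \<in> ?W" "x \<in> cball x0 \<rho>" "y \<in> cball x0 \<rho>" using that D(1,5) by blast+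
      then show ?thesis unfolding \<phi>0_def by (simp only: if_True L(2))
    qed
    show "norm (x - y) \<le> 2 * \<rho>" if "x \<in> D" "y \<in> D" for x y
    proof -
      have "x \<in> cball x0 \<rho>" "y \<in> cball x0 \<rho>" using that D(5) by blast+
      then show ?thesis using dist_triangle3[of x y x0] unfolding dist_norm[symmetric] by simp
    qed
  qed auto
  moreover have "0 < emeasure ?\<mu> U"
  proof -
    have "0 < ennreal a * emeasure lborel D"
      using a half_ball_emeasure_pos[of x0 i \<rho>] x0(1) \<rho>(1) by (simp add: D_def ennreal_zero_less_mult_iff)
    also have "\<dots> \<le> emeasure ?\<mu> U" using lower[of "\<lambda>_. 1"] U_sets D(2) by simp
    finally show ?thesis .
  qed
  moreover have "emeasure ?\<mu> U < \<infinity>"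
  proof -
    have "emeasure ?\<mu> U \<le> ennreal b * emeasure lborel D" using upper[of "\<lambda>_. 1"] U_sets D(2) by simp
    also have "\<dots> < \<infinity>"
      using emeasure_bounded_finite[OF bounded_subset[OF bounded_cball D(5)]] by (simp add: ennreal_mult_less_top)
    finally show ?thesis .
  qed
  ultimately show ?thesis
    using U_open U_V x0(2) D(4) unfolding U_def by (intro exI[of _ U]) (auto simp: U_def)
qed

section \<open>From energies of pairs to the kernel estimate\<close>

text \<open>For fixed \<open>x\<close>, expanding the square and using that the weighted mean vanishes gives
  \<open>\<integral> (u x - u y)\<^sup>2 p y dy = (u x)\<^sup>2 \<integral> p + \<integral> u\<^sup>2 p\<close>, which is at least \<open>c0 \<sqdot> measure M (space M) \<sqdot> (u x)\<^sup>2\<close>. Integrate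
  over \<open>x\<close>.\<close>

lemma (in finite_measure) weighted_mean_zero_le_pair_energy:
  fixes u p :: "'a \<Rightarrow> real"
  assumes u[measurable]: "u \<in> borel_measurable M" and u2: "integrable M (\<lambda>x. (u x)\<^sup>2)"
    and p[measurable]: "p \<in> borel_measurable M"
    and bounds: "0 < c0" "\<And>x. x \<in> space M \<Longrightarrow> c0 \<le> p x" "\<And>x. x \<in> space M \<Longrightarrow> p x \<le> c1"
    and mean: "(\<integral>x. u x * p x \<partial>M) = 0" and c1: "0 \<le> c1"
  shows "ennreal (c0 * measure M (space M) * (\<integral>x. (u x)\<^sup>2 \<partial>M)) \<le> ennreal c1 * pair_energy M u (space M) (space M)"
proof -
  let ?m = "measure M (space M)"
  have int_u: "integrable M u" by (rule square_integrable_imp_integrable[OF u u2])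
  have p_abs: "norm (p x) \<le> norm c1" if "x \<in> space M" for x using bounds(1) bounds(2,3)[OF that] by simp
  have int_p: "integrable M p"
    by (rule integrable_const_bound[of _ "norm c1"]) (use p_abs in auto)
  have int_mult: "integrable M (\<lambda>x. f x * p x)" if f: "integrable M f" for f :: "'a \<Rightarrow> real"
  proof (rule Bochner_Integration.integrable_bound)
    show "integrable M (\<lambda>x. f x * c1)" using f by simp
    show "AE x in M. norm (f x * p x) \<le> norm (f x * c1)"
      using p_abs by (auto simp: abs_mult intro!: AE_I2 mult_left_mono)
    show "(\<lambda>x. f x * p x) \<in> borel_measurable M" using f by measurable
  qed
  have int_sq: "integrable M (\<lambda>y. (u x - u y)\<^sup>2)" for x
    unfolding power2_diff using int_u u2 by simp
  have pt: "ennreal (c0 * ?m * (u x)\<^sup>2) \<le> ennreal c1 * (\<integral>\<^sup>+y. ennreal ((u x - u y)\<^sup>2) \<partial>M)" for x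
  proof -
    have "c0 * ?m \<le> (\<integral>y. p y \<partial>M)"
      using integral_mono[of M "\<lambda>_. c0" p] int_p bounds(2) by (simp add: mult.commute)
    then have "c0 * ?m * (u x)\<^sup>2 \<le> (\<integral>y. p y \<partial>M) * (u x)\<^sup>2" by (rule mult_right_mono) simp
    also have "\<dots> \<le> (u x)\<^sup>2 * (\<integral>y. p y \<partial>M) - 2 * u x * (\<integral>y. u y * p y \<partial>M) + (\<integral>y. (u y)\<^sup>2 * p y \<partial>M)"
    proof -
      have "0 \<le> (\<integral>y. (u y)\<^sup>2 * p y \<partial>M)"
        using bounds(1,2) by (intro integral_nonneg_AE AE_I2 mult_nonneg_nonneg) (auto intro: order_trans less_imp_le)
      then show ?thesis using mean by simp
    qed
    also have "\<dots> = (\<integral>y. (u x)\<^sup>2 * p y - 2 * u x * (u y * p y) + (u y)\<^sup>2 * p y \<partial>M)"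
      using int_p int_mult[OF int_u] int_mult[OF u2] by simp
    also have "\<dots> = (\<integral>y. (u x - u y)\<^sup>2 * p y \<partial>M)"
      by (intro Bochner_Integration.integral_cong) (auto simp: power2_eq_square algebra_simps)
    also have "\<dots> \<le> (\<integral>y. (u x - u y)\<^sup>2 * c1 \<partial>M)"
      using int_mult[OF int_sq] int_sq bounds(3) by (intro integral_mono mult_left_mono) auto
    also have "\<dots> = c1 * (\<integral>y. (u x - u y)\<^sup>2 \<partial>M)" by simp
    finally have "ennreal (c0 * ?m * (u x)\<^sup>2) \<le> ennreal (c1 * (\<integral>y. (u x - u y)\<^sup>2 \<partial>M))" by (rule ennreal_leI)
    also have "\<dots> = ennreal c1 * (\<integral>\<^sup>+y. ennreal ((u x - u y)\<^sup>2) \<partial>M)"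
      using c1 by (subst nn_integral_eq_integral[OF int_sq]) (auto simp: ennreal_mult')
    finally show ?thesis .
  qed
  have "ennreal (c0 * ?m * (\<integral>x. (u x)\<^sup>2 \<partial>M)) = (\<integral>\<^sup>+x. ennreal (c0 * ?m * (u x)\<^sup>2) \<partial>M)"
    using u2 bounds(1) by (subst nn_integral_eq_integral) auto
  also have "\<dots> \<le> (\<integral>\<^sup>+x. ennreal c1 * (\<integral>\<^sup>+y. ennreal ((u x - u y)\<^sup>2) \<partial>M) \<partial>M)"
    by (intro nn_integral_mono pt)
  also have "\<dots> = ennreal c1 * (\<integral>\<^sup>+x. \<integral>\<^sup>+y. ennreal ((u x - u y)\<^sup>2) \<partial>M \<partial>M)"
    by (intro nn_integral_cmult) measurable
  also have "(\<integral>\<^sup>+x. \<integral>\<^sup>+y. ennreal ((u x - u y)\<^sup>2) \<partial>M \<partial>M) = pair_energy M u (space M) (space M)"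
    unfolding pair_energy_def by (intro nn_integral_cong) simp
  finally show ?thesis .
qed

text \<open>The Bochner integral is zero for functions that are not integrable, so a lower bound for it needs integrability: the
  integrand is dominated by \<open>2 B ((u x)\<^sup>2 + (u y)\<^sup>2)\<close>.\<close>

lemma (in finite_measure) kernel_energy_eq_nn_integral:
  fixes u :: "'a \<Rightarrow> real" and k :: "'a \<Rightarrow> 'a \<Rightarrow> real"
  assumes u[measurable]: "u \<in> borel_measurable M" and u2: "integrable M (\<lambda>x. (u x)\<^sup>2)"
    and k[measurable]: "case_prod k \<in> borel_measurable (M \<Otimes>\<^sub>M M)"
    and bounds: "\<And>x y. x \<in> space M \<Longrightarrow> y \<in> space M \<Longrightarrow> 0 \<le> k x y \<and> k x y \<le> B"
  shows "ennreal (\<integral>y. \<integral>x. k x y * (u x - u y)\<^sup>2 \<partial>M \<partial>M)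
    = (\<integral>\<^sup>+y. \<integral>\<^sup>+x. ennreal (k x y * (u x - u y)\<^sup>2) \<partial>M \<partial>M)"
proof -
  let ?f = "\<lambda>x y. k x y * (u x - u y)\<^sup>2" and ?g = "\<lambda>x y. B * (2 * (u x)\<^sup>2 + 2 * (u y)\<^sup>2)"
  have f_nonneg: "0 \<le> ?f x y" if "x \<in> space M" "y \<in> space M" for x y
    using bounds[OF that] by simp
  have f_le: "?f x y \<le> ?g x y" if "x \<in> space M" "y \<in> space M" for x y
  proof -
    have "0 \<le> (u x + u y)\<^sup>2" by simp
    then have "(u x - u y)\<^sup>2 \<le> 2 * (u x)\<^sup>2 + 2 * (u y)\<^sup>2"
      by (simp add: power2_eq_square algebra_simps)
    then show ?thesis using bounds[OF that] by (intro mult_mono) auto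
  qed
  have int_g: "integrable M (\<lambda>x. ?g x y)" for y using u2 by simp
  have int_f: "integrable M (\<lambda>x. ?f x y)" if "y \<in> space M" for y
  proof (rule Bochner_Integration.integrable_bound[OF int_g[of y]])
    show "(\<lambda>x. ?f x y) \<in> borel_measurable M" using that by measurable
    show "AE x in M. norm (?f x y) \<le> norm (?g x y)"
    proof (rule AE_I2)
      fix x assume "x \<in> space M"
      then show "norm (?f x y) \<le> norm (?g x y)" using f_nonneg[of x y] f_le[of x y] that by simp
    qed
  qed
  have int_F: "integrable M (\<lambda>y. \<integral>x. ?f x y \<partial>M)"
  proof (rule Bochner_Integration.integrable_bound)
    show "integrable M (\<lambda>y. \<integral>x. ?g x y \<partial>M)"
    proof -
      have "(\<integral>x. ?g x y \<partial>M) = B * (2 * (\<integral>x. (u x)\<^sup>2 \<partial>M) + 2 * (u y)\<^sup>2 * measure M (space M))" for y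
        using u2 by simp
      then show ?thesis using u2 by simp
    qed
    show "(\<lambda>y. \<integral>x. ?f x y \<partial>M) \<in> borel_measurable M" by measurable
    show "AE y in M. norm (\<integral>x. ?f x y \<partial>M) \<le> norm (\<integral>x. ?g x y \<partial>M)"
    proof (rule AE_I2)
      fix y assume y: "y \<in> space M"
      have "0 \<le> (\<integral>x. ?f x y \<partial>M)" using f_nonneg y by (intro integral_nonneg_AE AE_I2) auto
      moreover have "(\<integral>x. ?f x y \<partial>M) \<le> (\<integral>x. ?g x y \<partial>M)"
        using f_le y by (intro integral_mono int_f int_g) auto
      ultimately show "norm (\<integral>x. ?f x y \<partial>M) \<le> norm (\<integral>x. ?g x y \<partial>M)" by simp
    qed
  qed
  have "ennreal (\<integral>y. \<integral>x. ?f x y \<partial>M \<partial>M) = (\<integral>\<^sup>+y. ennreal (\<integral>x. ?f x y \<partial>M) \<partial>M)"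
    using f_nonneg by (intro nn_integral_eq_integral[symmetric] int_F AE_I2 integral_nonneg_AE) auto
  also have "\<dots> = (\<integral>\<^sup>+y. \<integral>\<^sup>+x. ennreal (?f x y) \<partial>M \<partial>M)"
    using f_nonneg by (intro nn_integral_cong nn_integral_eq_integral[symmetric] int_f AE_I2) auto
  finally show ?thesis .
qed

lemma C_on_subset_imp_continuous_on:
  fixes f :: "'a::euclidean_space \<Rightarrow> 'b::real_normed_vector"
  assumes "C_on_subset n f M"
  shows "continuous_on M f"
  unfolding continuous_on_def
proof
  fix x assume x: "x \<in> M"
  from assms x have "\<exists>W g. open W \<and> x \<in> W \<and> C_on n g W \<and> (\<forall>y\<in>W \<inter> M. g y = f y)"
    unfolding C_on_subset_def by (rule bspec)
  then obtain W g where W: "open W" "x \<in> W" "C_on n g W" "\<forall>y\<in>W \<inter> M. g y = f y"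
    by (elim exE conjE)
  have "continuous_on W g"
  proof (cases n)
    case (Suc n')
    then have "\<forall>y\<in>W. g differentiable (at y)" using W(3) by simp
    then show ?thesis by (blast intro: continuous_at_imp_continuous_on differentiable_imp_continuous_within)
  qed (use W(3) in simp)
  then have "isCont g x" using continuous_on_eq_continuous_at[OF W(1)] W(2) by blast
  then have "(g \<longlongrightarrow> g x) (at x)" by (simp add: isCont_def)
  then have "(g \<longlongrightarrow> g x) (at x within M)" by (rule tendsto_within_subset) simp
  moreover have "eventually (\<lambda>y. g y = f y) (at x within M)"
    unfolding eventually_at_topological using W(1,2,4) by (intro exI[of _ W]) simp
  ultimately have "(f \<longlongrightarrow> g x) (at x within M)" by (rule Lim_transform_eventually)
  then show "(f \<longlongrightarrow> f x) (at x within M)" using W(2,4) x by simp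
qed

lemma C2_halfline_continuous: "C2_halfline R \<Longrightarrow> continuous_on {0..} R"
  unfolding C2_halfline_def continuous_on_eq_continuous_within
  by (meson atLeast_iff has_field_derivative_imp_has_derivative has_derivative_continuous)

text \<open>The normalization \<open>C\<^sub>t / t\<close> is exactly compensated by the power \<open>k + 2\<close> of the scale \<open>r = sqrt (2 t)\<close>, the
  radius up to which the kernel is bounded below: \<open>r\<^sup>2 / (4 t) = 1/2\<close>.\<close>

lemma heat_normalization_cancel:
  assumes "t > 0"
  shows "(4 * pi * t) powr (- real k / 2) / t * sqrt (2 * t) ^ (k + 2) = 2 * (2 * pi) powr (- real k / 2)"
proof -
  have "sqrt (2 * t) ^ k = (2 * t) powr (real k / 2)"
    using assms by (simp add: powr_half_sqrt[symmetric] powr_realpow[symmetric] powr_powr)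
  moreover have "(4 * pi * t) powr (- real k / 2) = (2 * pi) powr (- real k / 2) * (2 * t) powr (- real k / 2)"
    using assms by (subst powr_mult[symmetric]) (auto simp: algebra_simps)
  moreover have "(2 * t) powr (- real k / 2) * (2 * t) powr (real k / 2) = 1"
    using assms by (simp add: powr_add[symmetric])
  ultimately show ?thesis
    using assms by (simp add: power_add field_simps)
qed

theorem theorem3p9:
  fixes M :: "(real^'d) set" and p :: "real^'d \<Rightarrow> real" and R :: "real \<Rightarrow> real"
    and c0 c1 \<delta>0 :: real and \<mu> :: "(real^'d) measure" and Ct :: "real \<Rightarrow> real"
  defines "\<mu> \<equiv> volume_measure TYPE('k::{finite,wellorder}) M"
    and "Ct \<equiv> (\<lambda>t. (4 * pi * t) powr (- real CARD('k) / 2))"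
  assumes M: "smooth_submanifold TYPE('k) M" "compact M" "connected M"
    and p: "C_on_subset 1 p M" "0 < c0" "\<And>x. x \<in> M \<Longrightarrow> c0 \<le> p x \<and> p x \<le> c1"
    and R: "C2_halfline R" "\<And>r. 0 \<le> r \<Longrightarrow> 0 \<le> R r" "\<And>r. 1 < r \<Longrightarrow> R r = 0"
      "0 < \<delta>0" "\<And>r. 0 \<le> r \<Longrightarrow> r \<le> 1 / 2 \<Longrightarrow> \<delta>0 \<le> R r"
  shows "\<exists>C>0. \<exists>T0>0. \<forall>u \<in> L2_space \<mu>. (\<integral>x. u x * p x \<partial>\<mu>) = 0 \<longrightarrow>
           (\<forall>t. 0 < t \<and> t \<le> T0 \<longrightarrow>
             Ct t / t * (\<integral>y. (\<integral>x. R ((norm (x - y))\<^sup>2 / (4 * t)) * (u x - u y)\<^sup>2 * p x * p y \<partial>\<mu>) \<partial>\<mu>)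
               \<ge> C * (L2_norm \<mu> u)\<^sup>2)"
proof (cases "M = {}")
  case True
  then have "space \<mu> = {}" by (simp add: \<mu>_def space_volume_measure)
  then show ?thesis
    by (intro exI[of _ 1] conjI) (auto simp: L2_norm_def Bochner_Integration.integral_empty)
next
  case False
  let ?k = "CARD('k)"
  have sets_\<mu>: "sets \<mu> = sets (restrict_space borel M)" and space_\<mu>: "space \<mu> = M"
    by (simp_all add: \<mu>_def sets_volume_measure space_volume_measure)
  note loc = locally_near_controlled[OF M(1), folded \<mu>_def]
  have ctrl: "near_controlled \<mu> (?k + 2) M M"
    by (rule near_controlled_globalize(2)[OF M(2,3) sets_\<mu> loc])
  have fin: "finite_measure \<mu>"
    by (rule near_controlled_globalize(1)[OF M(2,3) sets_\<mu> loc])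
  interpret finite_measure \<mu> by (rule fin)
  define m where "m = measure \<mu> M"
  have m: "m > 0"
  proof -
    obtain y where "y \<in> M" using False by blast
    then obtain U where U: "openin (top_of_set M) U" "0 < emeasure \<mu> U" using loc[of M y] by auto
    have "emeasure \<mu> U \<le> emeasure \<mu> M"
      using emeasure_space[of \<mu> U] by (simp add: space_\<mu>)
    then show ?thesis using U(2) by (simp add: m_def emeasure_eq_measure)
  qed
  have c01: "0 < c1" "c0 \<le> c1" using p(2,3) False by fastforce+
  obtain K where K: "K \<ge> 0" "\<And>u r. u \<in> borel_measurable \<mu> \<Longrightarrow> 0 < r \<Longrightarrow> r \<le> 1 \<Longrightarrow>
      pair_energy \<mu> u M M \<le> ennreal (K / r ^ (?k + 2)) * near_energy \<mu> u r"
    using ctrl unfolding near_controlled_def by blast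
  \<comment> \<open>The final constant has this one in its denominator, so it must not be zero.\<close>
  define K' where "K' = K + 1"
  have K': "K' > 0" "\<And>u r. u \<in> borel_measurable \<mu> \<Longrightarrow> 0 < r \<Longrightarrow> r \<le> 1 \<Longrightarrow>
      pair_energy \<mu> u M M \<le> ennreal (K' / r ^ (?k + 2)) * near_energy \<mu> u r"
  proof -
    show "K' > 0" using K(1) by (simp add: K'_def)
    fix u :: "real^'d \<Rightarrow> real" and r :: real assume u: "u \<in> borel_measurable \<mu>" "0 < r" "r \<le> 1"
    have "ennreal (K / r ^ (?k + 2)) \<le> ennreal (K' / r ^ (?k + 2))"
      using u(2) by (intro ennreal_leI divide_right_mono) (auto simp: K'_def)
    then show "pair_energy \<mu> u M M \<le> ennreal (K' / r ^ (?k + 2)) * near_energy \<mu> u r"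
      using K(2)[OF u] by (meson mult_right_mono order_trans zero_le)
  qed
  have id_meas: "(\<lambda>y. y) \<in> measurable \<mu> borel"
    unfolding measurable_cong_sets[OF sets_\<mu> refl] by (rule measurable_restrict_space1) simp
  have p_meas: "p \<in> borel_measurable \<mu>"
    unfolding measurable_cong_sets[OF sets_\<mu> refl]
    by (intro borel_measurable_continuous_on_restrict C_on_subset_imp_continuous_on[OF p(1)])
  have R_cont: "continuous_on {0..} R" by (rule C2_halfline_continuous[OF R(1)])
  obtain B where B: "B \<ge> 0" "\<And>r. 0 \<le> r \<Longrightarrow> R r \<le> B"
  proof -
    have "compact (R ` {0..1})"
      by (intro compact_continuous_image continuous_on_subset[OF R_cont]) auto
    then have "bounded (R ` {0..1})" by (rule compact_imp_bounded)
    then obtain B where B: "\<forall>r\<in>{0..1}. \<bar>R r\<bar> \<le> B" by (auto simp: bounded_iff)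
    have "R r \<le> max B 0" if "0 \<le> r" for r
    proof (cases "r \<le> 1")
      case True
      then have "\<bar>R r\<bar> \<le> B" using that B by simp
      then show ?thesis by simp
    qed (simp add: R(3))
    then show ?thesis using that[of "max B 0"] by simp
  qed
  define C where "C = 2 * (2 * pi) powr (- real ?k / 2) * (\<delta>0 * c0\<^sup>2 * c0 * m / (c1 * K'))"
  show ?thesis
  proof (rule exI[of _ C], rule conjI[OF _ exI[of _ "1/2"]], goal_cases)
    case 1
    show "C > 0" unfolding C_def using m K'(1) c01 p(2) R(4) by simp
  next
    case 2
    show ?case
    proof (intro conjI ballI impI allI)
      fix u t assume u: "u \<in> L2_space \<mu>" and mean: "(\<integral>x. u x * p x \<partial>\<mu>) = 0" and t: "0 < t \<and> t \<le> (1/2::real)"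
      have u_meas: "u \<in> borel_measurable \<mu>" and u2: "integrable \<mu> (\<lambda>x. (u x)\<^sup>2)"
        using u by (auto simp: L2_space_def)
      define A where "A = (\<integral>x. (u x)\<^sup>2 \<partial>\<mu>)"
      define r where "r = sqrt (2 * t)"
      have r: "0 < r" "r \<le> 1" using t by (auto simp: r_def)
      define k where "k x y = R ((norm (x - y))\<^sup>2 / (4 * t)) * p x * p y" for x y
      define I where "I = (\<integral>y. \<integral>x. k x y * (u x - u y)\<^sup>2 \<partial>\<mu> \<partial>\<mu>)"
      have I_eq: "(\<integral>y. (\<integral>x. R ((norm (x - y))\<^sup>2 / (4 * t)) * (u x - u y)\<^sup>2 * p x * p y \<partial>\<mu>) \<partial>\<mu>) = I"
        unfolding I_def k_def by (simp add: ac_simps)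
      have "case_prod k \<in> borel_measurable (\<mu> \<Otimes>\<^sub>M \<mu>)"
      proof -
        note id_meas[measurable] p_meas[measurable]
        \<comment> \<open>Continuity of \<open>R\<close> is known on the half-line only.\<close>
        have [measurable]: "(\<lambda>s. R (max 0 s)) \<in> borel_measurable borel"
          by (intro borel_measurable_continuous_onI continuous_on_compose2[OF R_cont] continuous_intros) auto
        have "k = (\<lambda>x y. R (max 0 ((norm (x - y))\<^sup>2 / (4 * t))) * p x * p y)"
          using t by (intro ext) (simp add: k_def max_absorb2)
        then show ?thesis by simp
      qed
      moreover have "0 \<le> k x y \<and> k x y \<le> B * c1 * c1" if "x \<in> space \<mu>" "y \<in> space \<mu>" for x y
      proof -
        have "0 \<le> (norm (x - y))\<^sup>2 / (4 * t)" using t by simp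
        then have "0 \<le> R ((norm (x - y))\<^sup>2 / (4 * t))" "R ((norm (x - y))\<^sup>2 / (4 * t)) \<le> B"
          using R(2) B(2) by auto
        moreover have "0 \<le> p x" "p x \<le> c1" "0 \<le> p y" "p y \<le> c1"
          using p(2) p(3)[of x] p(3)[of y] that by (auto simp: space_\<mu>)
        ultimately show ?thesis unfolding k_def using B(1) c01 by (auto intro!: mult_mono mult_nonneg_nonneg)
      qed
      ultimately have I_nn: "ennreal I = (\<integral>\<^sup>+y. \<integral>\<^sup>+x. ennreal (k x y * (u x - u y)\<^sup>2) \<partial>\<mu> \<partial>\<mu>)"
        unfolding I_def by (rule kernel_energy_eq_nn_integral[OF u_meas u2])
      have near_I: "ennreal (\<delta>0 * c0\<^sup>2) * near_energy \<mu> u r \<le> ennreal I"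
      proof -
        have pt: "ennreal (\<delta>0 * c0\<^sup>2) * (ennreal ((u y - u x)\<^sup>2) * indicator {..r} (dist y x))
            \<le> ennreal (k x y * (u x - u y)\<^sup>2)" if "x \<in> space \<mu>" "y \<in> space \<mu>" for x y
        proof (cases "dist y x \<le> r")
          case True
          then have "(norm (x - y))\<^sup>2 \<le> r\<^sup>2"
            by (intro power_mono) (auto simp: dist_norm norm_minus_commute)
          then have "(norm (x - y))\<^sup>2 / (4 * t) \<le> 1 / 2" using t by (simp add: r_def field_simps)
          then have "\<delta>0 \<le> R ((norm (x - y))\<^sup>2 / (4 * t))" using t by (intro R(5)) auto
          moreover have "c0 \<le> p x" "c0 \<le> p y" using p(3) that by (auto simp: space_\<mu>)
          ultimately have "\<delta>0 * c0 * c0 \<le> k x y"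
            unfolding k_def using R(4) p(2) by (intro mult_mono) auto
          then have "\<delta>0 * c0\<^sup>2 * (u y - u x)\<^sup>2 \<le> k x y * (u x - u y)\<^sup>2"
            unfolding power2_commute[of "u y"] power2_eq_square[of c0] mult.assoc[symmetric]
            by (rule mult_right_mono) simp
          then have "ennreal (\<delta>0 * c0\<^sup>2 * (u y - u x)\<^sup>2) \<le> ennreal (k x y * (u x - u y)\<^sup>2)" by (rule ennreal_leI)
          then show ?thesis using True R(4) by (simp add: ennreal_mult)
        qed simp
        have "ennreal (\<delta>0 * c0\<^sup>2) * near_energy \<mu> u r
            = (\<integral>\<^sup>+y. \<integral>\<^sup>+x. ennreal (\<delta>0 * c0\<^sup>2) * (ennreal ((u y - u x)\<^sup>2) * indicator {..r} (dist y x)) \<partial>\<mu> \<partial>\<mu>)"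
        proof -
          note id_meas[measurable] u_meas[measurable]
          have [measurable]: "(\<lambda>(x, y). dist x y) \<in> borel_measurable (\<mu> \<Otimes>\<^sub>M \<mu>)" by measurable
          show ?thesis unfolding near_energy_def by (simp add: nn_integral_cmult)
        qed
        also have "\<dots> \<le> ennreal I"
          unfolding I_nn by (intro nn_integral_mono pt)
        finally show ?thesis .
      qed
      have "ennreal (c0 * m * A) \<le> ennreal c1 * pair_energy \<mu> u M M"
        using weighted_mean_zero_le_pair_energy[OF u_meas u2 p_meas p(2) _ _ mean] p(3) c01
        by (simp add: m_def A_def space_\<mu>)
      also have "\<dots> \<le> ennreal c1 * (ennreal (K' / r ^ (?k + 2)) * near_energy \<mu> u r)"
        by (intro mult_left_mono K'(2) u_meas r) simp
      also have "\<dots> = ennreal (c1 * K' / r ^ (?k + 2) / (\<delta>0 * c0\<^sup>2)) * (ennreal (\<delta>0 * c0\<^sup>2) * near_energy \<mu> u r)"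
        using c01 K'(1) r R(4) p(2) by (simp add: mult.assoc[symmetric] ennreal_mult[symmetric])
      also have "\<dots> \<le> ennreal (c1 * K' / r ^ (?k + 2) / (\<delta>0 * c0\<^sup>2)) * ennreal I"
        by (intro mult_left_mono near_I) simp
      also have "\<dots> = ennreal (c1 * K' / r ^ (?k + 2) / (\<delta>0 * c0\<^sup>2) * I)"
        using c01 K'(1) r R(4) p(2) by (intro ennreal_mult'[symmetric]) auto
      finally have "ennreal (c0 * m * A) \<le> ennreal (c1 * K' / r ^ (?k + 2) / (\<delta>0 * c0\<^sup>2) * I)" .
      moreover have "I \<ge> 0"
        unfolding I_def using \<open>\<And>y x. x \<in> space \<mu> \<Longrightarrow> y \<in> space \<mu> \<Longrightarrow> 0 \<le> k x y \<and> k x y \<le> B * c1 * c1\<close>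
        by (intro integral_nonneg_AE AE_I2) auto
      ultimately have "c0 * m * A \<le> c1 * K' / r ^ (?k + 2) / (\<delta>0 * c0\<^sup>2) * I"
        using c01 K'(1) r R(4) p(2) by (subst (asm) ennreal_le_iff) auto
      then have key: "\<delta>0 * c0\<^sup>2 * c0 * m / (c1 * K') * r ^ (?k + 2) * A \<le> I"
        using c01 K'(1) r R(4) p(2) by (simp add: field_simps)
      have "Ct t / t * r ^ (?k + 2) = 2 * (2 * pi) powr (- real ?k / 2)"
        unfolding Ct_def r_def using t by (intro heat_normalization_cancel) simp
      then have "C * A = (Ct t / t * r ^ (?k + 2)) * (\<delta>0 * c0\<^sup>2 * c0 * m / (c1 * K')) * A"
        unfolding C_def by (simp only:)
      also have "\<dots> = Ct t / t * (\<delta>0 * c0\<^sup>2 * c0 * m / (c1 * K') * r ^ (?k + 2) * A)"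
        by (simp only: ac_simps)
      also have "\<dots> \<le> Ct t / t * I"
        using key t by (intro mult_left_mono) (auto simp: Ct_def)
      finally show "Ct t / t * (\<integral>y. (\<integral>x. R ((norm (x - y))\<^sup>2 / (4 * t)) * (u x - u y)\<^sup>2 * p x * p y \<partial>\<mu>) \<partial>\<mu>)
          \<ge> C * (L2_norm \<mu> u)\<^sup>2"
        unfolding I_eq L2_norm_def by (simp add: A_def)
    qed simp
  qed
qed

end
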